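(* Let $k/\mathbb{Q}$ be a finite extension with ring of integers $\mathcal{O}_k$, and let $F\in\mathcal{O}_k[Y,X_1]$ be monic in $Y$ with $\deg_YF\ge 2$, irreducible over $k(X_1)$, and of total degree $D$. Define $\mathcal{L}_F=k(X_1)[Y]/(F(Y,X_1))$. The following are equivalent: (I) $F$ is a strongly $1$-genuine polynomial, that is to say, $k(X_1)[Y]/(F(Y,X_1))$ is a strongly $1$-genuine extension of $k(X_1)$. (II) $\overline{k}\cap\mathcal{L}_F=k$, that is to say, $k$ is integrally closed in $\mathcal{L}_F$ (equivalently, $\mathcal{L}_F$ is a regular extension of $k$). (III) $F(Y,X_1)$ is irreducible over $\overline{k}=\overline{\mathbb{Q}}$. (IV) Expanding $F(Y,X_1)=\sum_{\ell+m\le D}a_{\ell,m}Y^\ell X_1^m$, the Noether form $B_{\mathrm{red}}$ evaluated at the coefficients, $B_{\mathrm{red}}((a_{\ell,m})_{\ell,m})$, is nonzero.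
   Context: A finite (nontrivial) extension $M$ of $k(X_1)$ is a $1$-genuine extension if every $G(Y,X_1)\in k[Y,X_1]$ with $M=k(X_1)[Y]/(G)$ has nonzero degree in $X_1$. It is a strongly $1$-genuine extension if every $M'$ with $k(X_1)\subsetneq M'\subset M$ is a $1$-genuine extension of $k(X_1)$. A polynomial in $k[Y,X_1]$ that is monic in $Y$ and irreducible over $k(X_1)$ is strongly $1$-genuine if the extension of $k(X_1)$ it defines is strongly $1$-genuine. Here $\overline{k}\cap\mathcal{L}_F$ is the set of elements of $\mathcal{L}_F$ algebraic over $k$. A polynomial $f$ is reducible over $\overline{k}$ if $f=f_1f_2$ with $f_i\in\overline{k}[Y,X_1]$, $1\le\deg f_1<\deg f$. Noether form: for the given $D$ there is a finite collection of forms (homogeneous polynomials) with integer coefficients in the variables $(A_{\ell,m})_{\ell+m\le D}$, depending only on $D$, such that for every $f(Y,Z)=\sum_{\ell+m\le D}a_{\ell,m}Y^\ell Z^m$ with coefficients in $\mathcal{O}_k$, all the forms vanish at $(a_{\ell,m})$ if and only if $f$ is reducible over $\overline{\mathbb{Q}}$ or $\deg f<D$. $B_{\mathrm{red}}$ denotes this collection (treated as a single form); "$B_{\mathrm{red}}((a_{\ell,m}))$ is nonzero" means that not all of the forms vanish at $(a_{\ell,m})$. *)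

theory Defs
  imports
    "HOL-Algebra.Algebraic_Closure_Type"
    "HOL-Library.Poly_Mapping"
begin

text \<open>
  Bivariate polynomials in \<open>k[Y,X]\<close> have type \<open>'k poly poly\<close>: the outer variable is \<open>Y\<close>,
  the inner one is \<open>X\<close>, so the coefficient of \<open>Y\<^sup>l X\<^sup>m\<close> in \<open>f\<close> is
  \<open>bicoeff f l m\<close>.  The field \<open>k(X)\<close> is \<open>'k poly fract\<close>.  Names such as \<open>degree\<close> are
  qualified because HOL-Algebra uses them as well.
\<close>

definition number_field :: "'k::field_char_0 itself \<Rightarrow> bool" where
  "number_field _ \<longleftrightarrow>
     (\<exists>B. finite_dimensional_vector_space (\<lambda>(q::rat) (x::'k). of_rat q * x) B)"

definition bicoeff :: "'a::zero poly poly \<Rightarrow> nat \<Rightarrow> nat \<Rightarrow> 'a" where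
  "bicoeff f l m = Polynomial.coeff (Polynomial.coeff f l) m"

definition integral_coeffs :: "'k::field_char_0 poly poly \<Rightarrow> bool" where
  "integral_coeffs f \<longleftrightarrow> (\<forall>l m. algebraic_int (bicoeff f l m))"

text \<open>Both degrees are \<open>0\<close> for the zero polynomial.\<close>

definition total_degree :: "'a::zero poly poly \<Rightarrow> nat" where
  "total_degree f = Max (insert 0 {l + m | l m. bicoeff f l m \<noteq> 0})"

definition degree_X :: "'a::zero poly poly \<Rightarrow> nat" where
  "degree_X f = Max (insert 0 {m. \<exists>l. bicoeff f l m \<noteq> 0})"


subsection \<open>Extensions of \<open>k(X)\<close> and genuineness\<close>

definition over_kX :: "'k::field poly poly \<Rightarrow> 'k poly fract poly" where
  "over_kX G = map_poly to_fract G"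

abbreviation kXY :: "'k::field poly fract poly ring" where
  "kXY \<equiv> ring_of_type_algebra"

text \<open>The ring \<open>k(X)[Y]/(G)\<close> and its structure map from \<open>k(X)\<close>.\<close>

definition quot_ring :: "'k::field poly poly \<Rightarrow> 'k poly fract poly set ring" where
  "quot_ring G = kXY Quot (PIdl\<^bsub>kXY\<^esub> (over_kX G))"

definition quot_map :: "'k::field poly poly \<Rightarrow> 'k poly fract \<Rightarrow> 'k poly fract poly set" where
  "quot_map G a = (PIdl\<^bsub>kXY\<^esub> (over_kX G)) +>\<^bsub>kXY\<^esub> [:a:]"

text \<open>
  An extension of \<open>k(X)\<close> is a field \<open>M\<close> together with a (necessarily injective) ring
  homomorphism \<open>i\<close> from \<open>k(X)\<close> to \<open>M\<close>.
\<close>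

definition finite_nontrivial_extension ::
    "('k::field poly fract \<Rightarrow> 'm) \<Rightarrow> 'm ring \<Rightarrow> bool" where
  "finite_nontrivial_extension i M \<longleftrightarrow>
     Ring.field M \<and> i \<in> ring_hom ring_of_type_algebra M \<and>
     ring.finite_dimension M (range i) (carrier M) \<and> range i \<noteq> carrier M"

text \<open>The equality \<open>M = k(X)[Y]/(G)\<close> is isomorphism of extensions of \<open>k(X)\<close>.\<close>

definition presented_by ::
    "('k::field poly fract \<Rightarrow> 'm) \<Rightarrow> 'm ring \<Rightarrow> 'k poly poly \<Rightarrow> bool" where
  "presented_by i M G \<longleftrightarrow>
     (\<exists>\<phi> \<in> ring_iso (quot_ring G) M. \<forall>a. \<phi> (quot_map G a) = i a)"

definition one_genuine_extension ::
    "('k::field poly fract \<Rightarrow> 'm) \<Rightarrow> 'm ring \<Rightarrow> bool" where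
  "one_genuine_extension i M \<longleftrightarrow>
     finite_nontrivial_extension i M \<and>
     (\<forall>G. presented_by i M G \<longrightarrow> degree_X G \<noteq> 0)"

definition strongly_one_genuine_extension ::
    "('k::field poly fract \<Rightarrow> 'm) \<Rightarrow> 'm ring \<Rightarrow> bool" where
  "strongly_one_genuine_extension i M \<longleftrightarrow>
     finite_nontrivial_extension i M \<and>
     (\<forall>M'. subfield M' M \<and> range i \<subset> M' \<longrightarrow>
        one_genuine_extension i (M\<lparr>carrier := M'\<rparr>))"

definition strongly_one_genuine_poly :: "'k::field poly poly \<Rightarrow> bool" where
  "strongly_one_genuine_poly F \<longleftrightarrow>
     Polynomial.lead_coeff F = 1 \<and> Factorial_Ring.irreducible (over_kX F) \<and>
     strongly_one_genuine_extension (quot_map F) (quot_ring F)"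


subsection \<open>Elements algebraic over \<open>k\<close>\<close>

definition constants :: "'k::field poly poly \<Rightarrow> 'k poly fract poly set set" where
  "constants F = range (\<lambda>c. quot_map F (to_fract [:c:]))"

definition algebraic_elements :: "'k::field poly poly \<Rightarrow> 'k poly fract poly set set" where
  "algebraic_elements F =
     {x \<in> carrier (quot_ring F). (ring.algebraic (quot_ring F) over constants F) x}"


subsection \<open>Factorisation over the algebraic closure, and Noether forms\<close>

definition over_closure :: "'k::field poly poly \<Rightarrow> 'k alg_closure poly poly" where
  "over_closure f = map_poly (map_poly to_ac) f"

definition reducible_over_closure :: "'k::field poly poly \<Rightarrow> bool" where
  "reducible_over_closure f \<longleftrightarrow>
     (\<exists>f1 f2. over_closure f = f1 * f2 \<and>
        1 \<le> total_degree f1 \<and> total_degree f1 < total_degree f)"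

text \<open>
  Integer polynomials in the variables \<open>A\<^bsub>l,m\<^esub>\<close>: a monomial is a finitely supported exponent
  function on pairs \<open>(l,m)\<close>, a polynomial a finitely supported coefficient function on
  monomials.
\<close>

type_synonym coeff_poly = "((nat \<times> nat) \<Rightarrow>\<^sub>0 nat) \<Rightarrow>\<^sub>0 int"

definition is_form :: "nat \<Rightarrow> coeff_poly \<Rightarrow> bool" where
  "is_form D P \<longleftrightarrow>
     (\<forall>\<mu> \<in> Poly_Mapping.keys P. Poly_Mapping.keys \<mu> \<subseteq> {(l, m). l + m \<le> D}) \<and>
     (\<exists>d. \<forall>\<mu> \<in> Poly_Mapping.keys P.
        (\<Sum>v \<in> Poly_Mapping.keys \<mu>. Poly_Mapping.lookup \<mu> v) = d)"

definition eval_form :: "coeff_poly \<Rightarrow> (nat \<Rightarrow> nat \<Rightarrow> 'k::comm_ring_1) \<Rightarrow> 'k" where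
  "eval_form P a =
     (\<Sum>\<mu> \<in> Poly_Mapping.keys P. of_int (Poly_Mapping.lookup P \<mu>) *
        (\<Prod>v \<in> Poly_Mapping.keys \<mu>. a (fst v) (snd v) ^ Poly_Mapping.lookup \<mu> v))"

text \<open>
  \<open>B\<close> is a Noether form in degree \<open>D\<close> for the number field \<open>'k\<close>.  The algebraic closure of
  \<open>'k\<close> is the algebraic closure of the rationals.
\<close>

definition noether_form :: "'k::field_char_0 itself \<Rightarrow> nat \<Rightarrow> coeff_poly set \<Rightarrow> bool" where
  "noether_form _ D B \<longleftrightarrow>
     finite B \<and> (\<forall>P \<in> B. is_form D P) \<and>
     (\<forall>f :: 'k poly poly. integral_coeffs f \<and> total_degree f \<le> D \<longrightarrow>
        ((\<forall>P \<in> B. eval_form P (bicoeff f) = 0) \<longleftrightarrow>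
           reducible_over_closure f \<or> total_degree f < D))"

text \<open>A Noether form, treated as a single form, is nonzero if not all its members vanish.\<close>

definition form_nonzero :: "coeff_poly set \<Rightarrow> (nat \<Rightarrow> nat \<Rightarrow> 'k::comm_ring_1) \<Rightarrow> bool" where
  "form_nonzero B a \<longleftrightarrow> (\<exists>P \<in> B. eval_form P a \<noteq> 0)"

end

theory Submission
  imports Defs
begin

text \<open>
  Write \<open>E = k(X)\<close>, \<open>K\<close> for the algebraic closure of \<open>k\<close>, and \<open>L = E[Y]/(F)\<close> with \<open>y\<close> the class
  of \<open>Y\<close>.  Three of the four conditions are compared with one statement about divisibility in
  \<open>E[Y]\<close>, called \<open>regular_poly F\<close>: if \<open>p\<close> is a nonzero polynomial over \<open>k\<close> and \<open>F\<close> divides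
  \<open>p(h)\<close>, then \<open>F\<close> divides \<open>h - c\<close> for some \<open>c\<close> in \<open>k\<close>.  Every element of \<open>L\<close> has the form
  \<open>h(y)\<close>, so this says that the elements of \<open>L\<close> algebraic over \<open>k\<close> lie in \<open>k\<close>.

  Strongly genuine and regular (\<open>regular_poly_if_strongly_one_genuine\<close>,
  \<open>presented_intermediate_field_trivial\<close>): an intermediate field presented by a \<open>G\<close> of degree \<open>0\<close>
  in \<open>X\<close> is generated over \<open>E\<close> by a root of \<open>G\<close>, which is algebraic over \<open>k\<close>; if \<open>F\<close> is regular
  this root is in \<open>k\<close>, so that the field is \<open>E\<close>.  Conversely, let \<open>h(y)\<close> be algebraic over \<open>k\<close>
  but not in \<open>k\<close>.  Its minimal polynomial over \<open>E\<close> divides a polynomial over \<open>k\<close>, hence is a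
  product of factors \<open>T - \<alpha>\<close> with \<open>\<alpha>\<close> in \<open>K\<close>, and its coefficients lie in \<open>K \<inter> E = k\<close>.  So the
  intermediate field \<open>E(h(y))\<close>, which differs from \<open>E\<close>, has a presentation of degree \<open>0\<close> in \<open>X\<close>.

  Irreducible over \<open>K\<close> implies regular (\<open>regular_poly_if_irreducible_over_closure\<close>): by Gauss's
  lemma \<open>F\<close> is a prime of \<open>K(X)[Y]\<close>.  If \<open>F\<close> divides \<open>p(h)\<close>, where \<open>p\<close> is a product of linear
  factors over \<open>K\<close>, then \<open>F\<close> divides \<open>h - \<alpha>\<close> for a root \<open>\<alpha>\<close> of \<open>p\<close>.  After a reduction of \<open>h\<close>
  modulo \<open>F\<close>, comparison of degrees gives \<open>h = \<alpha>\<close>, and \<open>\<alpha>\<close> is in \<open>K \<inter> E = k\<close>.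

  Regular implies irreducible over \<open>K\<close> (\<open>irreducible_over_closure_if_regular_poly\<close>): let \<open>f\<close> be a
  proper monic factor of \<open>F\<close> over \<open>K\<close>, and let \<open>y\<close> be a root of \<open>f\<close>.  By the primitive element
  theorem the coefficients of \<open>f\<close> lie in \<open>k(\<theta>)\<close> for some \<open>\<theta>\<close>, of degree \<open>d\<close> over \<open>k\<close> say.  Expand
  \<open>f\<close> as the sum of the \<open>\<theta>\<^sup>j \<phi>\<^sub>j\<close> for \<open>j < d\<close> with \<open>\<phi>\<^sub>j\<close> over \<open>k\<close>.  Then \<open>\<phi>\<^sub>0\<close> has the same degree in
  \<open>Y\<close> as \<open>f\<close>, less than that of \<open>F\<close>, so that \<open>\<phi>\<^sub>0(y)\<close> is not \<open>0\<close>, and \<open>f(y) = 0\<close> is an equation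
  for \<open>\<theta>\<close> over \<open>E(y)\<close> of degree less than \<open>d\<close>.  But the minimal polynomial of \<open>\<theta>\<close> over \<open>E(y)\<close>
  divides a polynomial over \<open>k\<close>, so its coefficients are algebraic over \<open>k\<close> and, by regularity,
  they lie in \<open>k\<close>.  This contradicts the definition of \<open>d\<close>.

  The statement on Noether forms rests on additivity of the total degree: the defining
  property of the forms speaks of a factor whose total degree is neither \<open>0\<close> nor the full one, and
  such a factor is the same as a factorisation into two non-units.
\<close>

hide_const (open) Polynomials.degree Polynomials.lead_coeff

section \<open>Embeddings of integral domains\<close>

text \<open>
  The argument moves polynomials along several inclusions, between \<open>k\<close>, its closure, the polynomial
  rings and function fields over both, and an algebraic closure of the larger function field.
  This locale treats them uniformly.
\<close>
locale ring_embedding =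
  fixes h :: "'a::idom \<Rightarrow> 'b::idom"
  assumes hom_add: "h (x + y) = h x + h y"
    and hom_mult: "h (x * y) = h x * h y"
    and hom_one: "h 1 = 1"
    and hom_eq_0: "h x = 0 \<Longrightarrow> x = 0"
begin

lemma hom_zero: "h 0 = 0"
  using hom_add[of 0 0] by (metis add.right_neutral add_left_cancel)

lemma hom_uminus: "h (- x) = - h x"
  using hom_add[of x "- x"] by (simp add: hom_zero eq_neg_iff_add_eq_0 add.commute)

lemma hom_diff: "h (x - y) = h x - h y"
  using hom_add[of x "- y"] by (simp add: hom_uminus)

lemma hom_eq_0_iff: "h x = 0 \<longleftrightarrow> x = 0"
  using hom_eq_0 hom_zero by blast

lemma hom_eq_iff: "h x = h y \<longleftrightarrow> x = y"
  using hom_eq_0_iff[of "x - y"] by (simp add: hom_diff)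

lemma hom_sum: "h (sum f A) = (\<Sum>x\<in>A. h (f x))"
  by (induction A rule: infinite_finite_induct) (auto simp: hom_zero hom_add)

lemma hom_power: "h (x ^ n) = h x ^ n"
  by (induction n) (auto simp: hom_one hom_mult)

lemma hom_of_nat: "h (of_nat n) = of_nat n"
  by (induction n) (auto simp: hom_zero hom_one hom_add)

lemma coeff_map_poly_hom: "Polynomial.coeff (map_poly h p) n = h (Polynomial.coeff p n)"
  by (simp add: coeff_map_poly hom_zero)

lemma degree_map_poly_hom: "degree (map_poly h p) = degree p"
  by (rule degree_map_poly) (simp add: hom_eq_0_iff)

lemma lead_coeff_map_poly_hom: "lead_coeff (map_poly h p) = h (lead_coeff p)"
  by (simp add: degree_map_poly_hom coeff_map_poly_hom)

lemma map_poly_hom_add: "map_poly h (p + q) = map_poly h p + map_poly h q"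
  by (rule poly_eqI) (simp add: coeff_map_poly_hom hom_add)

lemma map_poly_hom_mult: "map_poly h (p * q) = map_poly h p * map_poly h q"
  by (rule poly_eqI) (simp add: coeff_map_poly_hom coeff_mult hom_sum hom_mult)

text \<open>
  Embeddings lift to polynomial rings, so the lift can be iterated for polynomials in two variables.
\<close>
lemma map_poly_embedding: "ring_embedding (map_poly h)"
proof
  fix p assume "map_poly h p = 0"
  thus "p = 0"
    by (metis coeff_0 coeff_map_poly_hom hom_eq_0 poly_eqI)
qed (simp_all add: map_poly_hom_add map_poly_hom_mult hom_one)

lemma map_poly_hom_pCons: "map_poly h (pCons a p) = pCons (h a) (map_poly h p)"
  by (simp add: map_poly_pCons hom_zero)

lemma poly_map_poly_hom: "poly (map_poly h p) (h x) = h (poly p x)"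
  by (induction p) (simp_all add: map_poly_hom_pCons hom_zero hom_add hom_mult)

lemma map_poly_hom_pcompose: "map_poly h (pcompose p q) = pcompose (map_poly h p) (map_poly h q)"
  by (induction p)
     (simp_all add: map_poly_hom_pCons hom_zero pcompose_pCons map_poly_hom_add map_poly_hom_mult)

lemma map_poly_hom_pderiv: "map_poly h (pderiv p) = pderiv (map_poly h p)"
  by (rule poly_eqI)
     (simp add: coeff_map_poly_hom coeff_pderiv hom_mult hom_add hom_one hom_of_nat del: of_nat_Suc)

lemma map_poly_hom_dvd: "p dvd q \<Longrightarrow> map_poly h p dvd map_poly h q"
  by (auto simp: dvd_def map_poly_hom_mult)

lemma map_poly_hom_eq_0_iff: "map_poly h p = 0 \<longleftrightarrow> p = 0"
  by (rule ring_embedding.hom_eq_0_iff[OF map_poly_embedding])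

lemma map_poly_hom_diff: "map_poly h (p - q) = map_poly h p - map_poly h q"
  by (rule ring_embedding.hom_diff[OF map_poly_embedding])

end

lemma ring_embedding_compose:
  assumes "ring_embedding f" "ring_embedding g"
  shows "ring_embedding (\<lambda>x. g (f x))"
proof -
  interpret f: ring_embedding f by fact
  interpret g: ring_embedding g by fact
  show ?thesis
    by unfold_locales
       (simp_all add: f.hom_add f.hom_mult f.hom_one g.hom_add g.hom_mult g.hom_one
          f.hom_eq_0_iff g.hom_eq_0_iff)
qed

lemma map_poly_embedding_compose:
  assumes "ring_embedding f" "ring_embedding g"
  shows "map_poly g (map_poly f p) = map_poly (\<lambda>x. g (f x)) p"
proof -
  interpret f: ring_embedding f by fact
  interpret g: ring_embedding g by fact
  show ?thesis
    by (rule poly_eqI) (simp add: coeff_map_poly f.hom_zero g.hom_zero)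
qed

lemma to_ac_embedding: "ring_embedding (to_ac :: 'a::field \<Rightarrow> _)"
  by unfold_locales simp_all

lemma to_fract_embedding: "ring_embedding (to_fract :: 'a::idom \<Rightarrow> _)"
  by unfold_locales simp_all

lemma const_poly_embedding: "ring_embedding (\<lambda>c::'a::idom. [:c:])"
  by unfold_locales (simp_all add: one_pCons)

text \<open>
  The induced map on fraction fields.  A fraction has no canonical numerator and denominator over a
  general domain, so a representation is chosen; the value does not depend on it when \<open>h\<close> is an
  embedding.
\<close>
definition fract_map :: "('a::idom \<Rightarrow> 'b::idom) \<Rightarrow> 'a fract \<Rightarrow> 'b fract" where
  "fract_map h x = (let (a, b) = (SOME (a, b). b \<noteq> 0 \<and> x = Fract a b) in Fract (h a) (h b))"

context ring_embedding
begin

lemma fract_map_Fract: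
  assumes "b \<noteq> 0"
  shows "fract_map h (Fract a b) = Fract (h a) (h b)"
proof -
  define P where "P = (\<lambda>(c, d). d \<noteq> 0 \<and> Fract a b = Fract c d)"
  define cd where "cd = (SOME cd. P cd)"
  have "P (a, b)"
    using assms by (simp add: P_def)
  hence "P cd"
    unfolding cd_def by (rule someI)
  then obtain c d where cd: "cd = (c, d)" "d \<noteq> 0" "Fract a b = Fract c d"
    by (auto simp: P_def)
  have "h a * h d = h c * h b"
    using cd assms by (simp add: eq_fract flip: hom_mult)
  moreover have "fract_map h (Fract a b) = Fract (h c) (h d)"
    using cd(1) by (simp add: fract_map_def cd_def P_def)
  moreover have "Fract (h c) (h d) = Fract (h a) (h b)"
    using \<open>h a * h d = h c * h b\<close> assms cd(2) by (simp add: eq_fract hom_eq_0_iff)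
  ultimately show ?thesis by simp
qed

lemma fract_map_to_fract: "fract_map h (to_fract a) = to_fract (h a)"
  by (simp add: to_fract_def fract_map_Fract hom_one)

lemma fract_map_embedding: "ring_embedding (fract_map h)"
proof
  fix x y :: "'a fract"
  obtain a b where x: "x = Fract a b" "b \<noteq> 0" by (cases x)
  obtain c d where y: "y = Fract c d" "d \<noteq> 0" by (cases y)
  show "fract_map h (x + y) = fract_map h x + fract_map h y"
    using x y by (simp add: fract_map_Fract hom_eq_0_iff hom_add hom_mult)
  show "fract_map h (x * y) = fract_map h x * fract_map h y"
    using x y by (simp add: fract_map_Fract hom_mult)
  show "fract_map h 1 = 1"
    using fract_map_to_fract[of 1] by (simp add: hom_one)
  show "x = 0" if "fract_map h x = 0"
    using that x by (simp add: fract_map_Fract Zero_fract_def eq_fract hom_eq_0_iff)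
qed

end

section \<open>Principal ideals and minimal polynomials over a subfield\<close>

text \<open>
  Subfields of a type, as sets: the proof needs polynomial division over extensions such as \<open>k(\<theta>)\<close>,
  which depend on elements and therefore are not types.
\<close>
definition is_subfield :: "'a::field set \<Rightarrow> bool" where
  "is_subfield S \<longleftrightarrow> 1 \<in> S \<and> (\<forall>x\<in>S. \<forall>y\<in>S. x - y \<in> S \<and> x * y \<in> S \<and> inverse x \<in> S)"

definition polys_over :: "'a::zero set \<Rightarrow> 'a poly set" where
  "polys_over S = {p. \<forall>i. Polynomial.coeff p i \<in> S}"

lemma is_subfieldD:
  assumes "is_subfield S"
  shows "1 \<in> S" "0 \<in> S" "x \<in> S \<Longrightarrow> y \<in> S \<Longrightarrow> x - y \<in> S" "x \<in> S \<Longrightarrow> y \<in> S \<Longrightarrow> x + y \<in> S"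
    "x \<in> S \<Longrightarrow> y \<in> S \<Longrightarrow> x * y \<in> S" "x \<in> S \<Longrightarrow> inverse x \<in> S"
    "x \<in> S \<Longrightarrow> y \<in> S \<Longrightarrow> x / y \<in> S" "x \<in> S \<Longrightarrow> - x \<in> S"
proof -
  show [simp]: "1 \<in> S" and diff: "\<And>x y. x \<in> S \<Longrightarrow> y \<in> S \<Longrightarrow> x - y \<in> S"
    and mult: "\<And>x y. x \<in> S \<Longrightarrow> y \<in> S \<Longrightarrow> x * y \<in> S" and inv: "\<And>x. x \<in> S \<Longrightarrow> inverse x \<in> S"
    using assms by (auto simp: is_subfield_def)
  show [simp]: "0 \<in> S"
    using diff[of 1 1] by simp
  show minus: "- x \<in> S" if "x \<in> S" for x
    using diff[of 0 x] that by simp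
  show "x + y \<in> S" if "x \<in> S" "y \<in> S"
    using diff[OF that(1) minus[OF that(2)]] by simp
  show "x / y \<in> S" if "x \<in> S" "y \<in> S"
    using mult[OF that(1) inv[OF that(2)]] by (simp add: divide_inverse)
qed

lemma is_subfield_sum:
  assumes "is_subfield S" "\<And>i. i \<in> A \<Longrightarrow> f i \<in> S"
  shows "sum f A \<in> S"
  using assms(2) by (induction A rule: infinite_finite_induct)
    (auto intro: is_subfieldD[OF assms(1)])

lemma is_subfield_power:
  assumes "is_subfield S" "x \<in> S"
  shows "x ^ n \<in> S"
  by (induction n) (auto intro: is_subfieldD[OF assms(1)] assms(2))

lemma is_subfield_poly:
  assumes "is_subfield S" "p \<in> polys_over S" "x \<in> S"
  shows "poly p x \<in> S"
  using assms(2) unfolding poly_altdef polys_over_def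
  by (auto intro!: is_subfield_sum is_subfieldD is_subfield_power assms)

lemma is_subfield_UNIV: "is_subfield UNIV"
  by (simp add: is_subfield_def)

lemma polys_over_UNIV [simp]: "polys_over UNIV = UNIV"
  by (simp add: polys_over_def)

lemma polys_over_coeff: "p \<in> polys_over S \<Longrightarrow> Polynomial.coeff p i \<in> S"
  by (simp add: polys_over_def)

lemma polys_over_closed:
  assumes "is_subfield S"
  shows "p \<in> polys_over S \<Longrightarrow> q \<in> polys_over S \<Longrightarrow> p - q \<in> polys_over S"
    "p \<in> polys_over S \<Longrightarrow> q \<in> polys_over S \<Longrightarrow> p + q \<in> polys_over S"
    "p \<in> polys_over S \<Longrightarrow> q \<in> polys_over S \<Longrightarrow> p * q \<in> polys_over S"
    "c \<in> S \<Longrightarrow> Polynomial.monom c n \<in> polys_over S"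
    "c \<in> S \<Longrightarrow> p \<in> polys_over S \<Longrightarrow> pCons c p \<in> polys_over S"
    "c \<in> S \<Longrightarrow> p \<in> polys_over S \<Longrightarrow> Polynomial.smult c p \<in> polys_over S"
    "0 \<in> polys_over S"
  by (auto simp: polys_over_def coeff_mult coeff_pCons intro!: is_subfieldD[OF assms]
        is_subfield_sum[OF assms] split: nat.splits)

lemma polys_over_sum:
  assumes "is_subfield S" "\<And>i. i \<in> A \<Longrightarrow> f i \<in> polys_over S"
  shows "sum f A \<in> polys_over S"
  using assms(2) by (induction A rule: infinite_finite_induct)
    (auto intro: polys_over_closed[OF assms(1)])

lemma polys_over_pcompose:
  assumes "is_subfield S" "p \<in> polys_over S" "q \<in> polys_over S"
  shows "pcompose p q \<in> polys_over S"
  using assms(2)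
proof (induction p)
  case (pCons a p)
  have "a \<in> S" "p \<in> polys_over S"
    using pCons.prems polys_over_coeff[OF pCons.prems, of 0]
      polys_over_coeff[OF pCons.prems, of "Suc i" for i] by (auto simp: polys_over_def)
  thus ?case
    using pCons.IH by (auto simp: pcompose_pCons intro!: polys_over_closed[OF assms(1)] assms(3))
qed (simp add: polys_over_closed[OF assms(1)])

text \<open>
  A version of division with remainder that keeps the quotient over the subfield: subtract a
  multiple of \<open>m\<close> that cancels the leading term, and repeat.
\<close>
lemma polys_over_division:
  assumes S: "is_subfield S" and "m \<in> polys_over S" "p \<in> polys_over S" "m \<noteq> 0"
  shows "\<exists>q\<in>polys_over S. p - q * m = 0 \<or> degree (p - q * m) < degree m"
  using assms(3)
proof (induction "degree p" arbitrary: p rule: less_induct)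
  case less
  show ?case
  proof (cases "degree p < degree m \<or> degree p = 0")
    case True
    show ?thesis
    proof (cases "degree p < degree m")
      case True
      thus ?thesis
        by (intro bexI[of _ 0]) (auto intro: polys_over_closed[OF S])
    next
      case False
      with True have "degree m = 0" "degree p = 0" by auto
      then obtain a b where ab: "m = [:a:]" "p = [:b:]"
        by (metis degree_eq_zeroE)
      have "a \<in> S" "b \<in> S" "a \<noteq> 0"
        using ab assms(2,4) less.prems polys_over_coeff[of m S 0] polys_over_coeff[of p S 0] by auto
      thus ?thesis
        using ab by (intro bexI[of _ "[:b / a:]"])
          (auto intro!: polys_over_closed[OF S] is_subfieldD[OF S])
    qed
  next
    case False
    define c where "c = lead_coeff p / lead_coeff m"
    define t where "t = Polynomial.monom c (degree p - degree m)"
    have c: "c \<in> S"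
      unfolding c_def using assms(2) less.prems
      by (intro is_subfieldD[OF S]) (auto intro: polys_over_coeff)
    have t: "t \<in> polys_over S"
      unfolding t_def using c by (intro polys_over_closed[OF S])
    have "p \<noteq> 0" using False by auto
    hence "c \<noteq> 0" using assms(4) by (simp add: c_def)
    have deg: "degree (t * m) = degree p"
      using False \<open>c \<noteq> 0\<close> assms(4) by (simp add: t_def degree_mult_eq monom_eq_0_iff degree_monom_eq)
    moreover have "lead_coeff (t * m) = lead_coeff p"
    proof -
      have "lead_coeff t = c" unfolding t_def by (rule lead_coeff_monom)
      thus ?thesis
        using assms(4) by (simp only: lead_coeff_mult) (simp add: c_def)
    qed
    ultimately have "degree (p - t * m) \<le> degree p" "Polynomial.coeff (p - t * m) (degree p) = 0"
      by (auto intro: degree_diff_le)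
    hence "degree (p - t * m) < degree p"
      using False by (metis degree_0 leading_coeff_0_iff le_neq_implies_less)
    moreover have "p - t * m \<in> polys_over S"
      by (intro polys_over_closed[OF S] t assms less.prems)
    ultimately obtain q where q: "q \<in> polys_over S"
      "p - t * m - q * m = 0 \<or> degree (p - t * m - q * m) < degree m"
      using less.hyps by blast
    show ?thesis
      using q t by (intro bexI[of _ "t + q"])
        (auto simp: algebra_simps intro!: polys_over_closed[OF S])
  qed
qed

text \<open>
  Ideals of the polynomial ring over a subfield are principal.  Every minimal polynomial below is a
  generator obtained from this lemma, for an ideal of polynomials that vanish at a point or modulo
  a prime.
\<close>
lemma principal_generator:
  assumes S: "is_subfield S" and I: "I \<subseteq> polys_over S"
    and diff: "\<And>p q. p \<in> I \<Longrightarrow> q \<in> I \<Longrightarrow> p - q \<in> I"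
    and mult: "\<And>p q. p \<in> polys_over S \<Longrightarrow> q \<in> I \<Longrightarrow> p * q \<in> I"
    and nz: "p \<in> I" "p \<noteq> 0"
  obtains m where "m \<in> I" "lead_coeff m = 1" "\<And>q. q \<in> I \<Longrightarrow> m dvd q"
proof -
  \<comment> \<open>A nonzero element of least degree generates; remainders after division by it must vanish.\<close>
  obtain d where d: "d \<in> I" "d \<noteq> 0" "\<And>q. q \<in> I \<Longrightarrow> q \<noteq> 0 \<Longrightarrow> degree d \<le> degree q"
    using ex_has_least_nat[of "\<lambda>p. p \<in> I \<and> p \<noteq> 0" p degree] nz by blast
  define m where "m = [:inverse (lead_coeff d):] * d"
  show thesis
  proof
    have "inverse (lead_coeff d) \<in> S"
      using I d(1) by (intro is_subfieldD[OF S] polys_over_coeff) auto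
    thus m: "m \<in> I"
      unfolding m_def by (intro mult d polys_over_closed[OF S])
    show lm: "lead_coeff m = 1"
      using d(2) by (simp add: m_def lead_coeff_mult)
    have dm: "degree m = degree d"
      using d(2) by (simp add: m_def)
    fix q assume q: "q \<in> I"
    have "m \<noteq> 0" using lm by auto
    then obtain r where r: "r \<in> polys_over S" "q - r * m = 0 \<or> degree (q - r * m) < degree m"
      using polys_over_division[OF S, of m q] m q I by blast
    have "q - r * m \<in> I"
      by (intro diff mult q r m)
    hence "q - r * m = 0"
      using r(2) d(3) dm by (metis leD)
    thus "m dvd q" by (simp add: dvd_def mult.commute)
  qed
qed

lemma minimal_polynomial_over:
  assumes S: "is_subfield S" and "p \<in> polys_over S" "p \<noteq> 0" "poly p x = 0"
  obtains m where "m \<in> polys_over S" "poly m x = 0" "lead_coeff m = 1"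
    "\<And>q. q \<in> polys_over S \<Longrightarrow> poly q x = 0 \<Longrightarrow> m dvd q"
proof -
  define I where "I = {q \<in> polys_over S. poly q x = 0}"
  obtain m where "m \<in> I" "lead_coeff m = 1" "\<And>q. q \<in> I \<Longrightarrow> m dvd q"
    by (rule principal_generator[OF S, of I p])
       (use assms in \<open>auto simp: I_def intro!: polys_over_closed[OF S]\<close>)
  thus ?thesis
    using that by (auto simp: I_def)
qed

text \<open>
  The same for a base field that is a type.  The generator is prime because the ideal is the kernel
  of an evaluation into a field.
\<close>
lemma minimal_polynomial:
  fixes h :: "'a::field \<Rightarrow> 'b::field"
  assumes "ring_embedding h" "p \<noteq> 0" "poly (map_poly h p) x = 0"
  obtains m where "poly (map_poly h m) x = 0" "lead_coeff m = 1"
    "\<And>q. poly (map_poly h q) x = 0 \<Longrightarrow> m dvd q" "prime_elem m"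
proof -
  interpret ring_embedding h by fact
  define I where "I = {q. poly (map_poly h q) x = 0}"
  obtain m where "m \<in> I" "lead_coeff m = 1" "\<And>q. q \<in> I \<Longrightarrow> m dvd q"
    by (rule principal_generator[OF is_subfield_UNIV, of I p])
       (use assms in \<open>auto simp: I_def map_poly_hom_diff map_poly_hom_mult\<close>)
  hence m: "poly (map_poly h m) x = 0" "lead_coeff m = 1"
    "\<And>q. poly (map_poly h q) x = 0 \<Longrightarrow> m dvd q"
    unfolding I_def by blast+
  have dvd_iff: "m dvd q \<longleftrightarrow> poly (map_poly h q) x = 0" for q
  proof
    assume "m dvd q"
    then obtain r where "q = m * r" by (rule dvdE)
    thus "poly (map_poly h q) x = 0"
      by (simp add: map_poly_hom_mult m(1))
  qed (rule m(3))
  have "prime_elem m"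
  proof (rule prime_elemI)
    show "m \<noteq> 0"
      using m(2) by auto
    show "\<not> is_unit m"
      unfolding dvd_iff by (simp add: hom_one)
    show "m dvd a \<or> m dvd b" if "m dvd a * b" for a b
      using that unfolding dvd_iff by (simp add: map_poly_hom_mult)
  qed
  thus ?thesis
    using that m by blast
qed

lemma irreducible_dvd_of_common_root:
  fixes h :: "'a::field \<Rightarrow> 'b::field"
  assumes "ring_embedding h" and f: "Factorial_Ring.irreducible f" "poly (map_poly h f) x = 0"
    and "poly (map_poly h q) x = 0"
  shows "f dvd q"
proof -
  interpret ring_embedding h by fact
  obtain m where m: "poly (map_poly h m) x = 0" "lead_coeff m = 1"
    "\<And>q. poly (map_poly h q) x = 0 \<Longrightarrow> m dvd q"
  proof -
    have "f \<noteq> 0" using f(1) by auto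
    from minimal_polynomial[OF assms(1) this f(2)] show ?thesis using that by blast
  qed
  have "\<not> is_unit m"
  proof
    assume "is_unit m"
    then obtain c where "m = [:c:]"
      by (auto simp: is_unit_poly_iff)
    with m(1,2) show False
      by (simp add: map_poly_hom_pCons hom_one)
  qed
  hence "f dvd m"
    using irreducibleD'[OF f(1) m(3)[OF f(2)]] by blast
  thus ?thesis
    using m(3)[OF assms(4)] dvd_trans by blast
qed

text \<open>
  The ideal generated by \<open>f\<close> and \<open>g\<close> has a generator that divides \<open>f\<close>; as \<open>f\<close> is irreducible and does
  not divide \<open>g\<close>, this generator is a unit.
\<close>
lemma irreducible_bezout:
  fixes f :: "'a::field poly"
  assumes "Factorial_Ring.irreducible f" "\<not> f dvd g"
  obtains a b where "a * f + b * g = 1"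
proof -
  define I where "I = range (\<lambda>(a, b). a * f + b * g)"
  have mem: "a * f + b * g \<in> I" for a b
    unfolding I_def by (rule image_eqI[of _ _ "(a, b)"]) auto
  have "f \<in> I" "g \<in> I"
    using mem[of 1 0] mem[of 0 1] by auto
  obtain m where m: "m \<in> I" "lead_coeff m = 1" "\<And>q. q \<in> I \<Longrightarrow> m dvd q"
  proof (rule principal_generator[OF is_subfield_UNIV, of I f])
    fix p q assume "p \<in> I" "q \<in> I"
    then obtain a b c d where "p = a * f + b * g" "q = c * f + d * g"
      by (auto simp: I_def)
    hence "p - q = (a - c) * f + (b - d) * g"
      by (simp add: algebra_simps)
    thus "p - q \<in> I" using mem by simp
  next
    fix p q assume "q \<in> I"
    then obtain c d where "q = c * f + d * g"
      by (auto simp: I_def)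
    hence "p * q = (p * c) * f + (p * d) * g"
      by (simp add: algebra_simps)
    thus "p * q \<in> I" using mem by simp
  qed (use assms \<open>f \<in> I\<close> in auto)
  have "is_unit m"
    using irreducibleD'[OF assms(1) m(3)[OF \<open>f \<in> I\<close>]] m(3)[OF \<open>g \<in> I\<close>] assms(2) dvd_trans
    by blast
  then obtain u where "1 = m * u" by (auto elim: dvdE)
  moreover obtain a b where "m = a * f + b * g"
    using m(1) by (auto simp: I_def)
  ultimately have "(u * a) * f + (u * b) * g = 1"
    by (simp add: algebra_simps)
  thus ?thesis by (rule that)
qed

section \<open>Simple extensions and primitive elements\<close>

text \<open>
  The values at \<open>x\<close> of the polynomials over the base field; for algebraic \<open>x\<close> this is the field
  generated by \<open>x\<close>, see \<open>adjoin_subfield\<close>.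
\<close>
definition adjoin :: "('a::field \<Rightarrow> 'b::field) \<Rightarrow> 'b \<Rightarrow> 'b set" where
  "adjoin h x = range (\<lambda>p. poly (map_poly h p) x)"

context
  fixes h :: "'a::field \<Rightarrow> 'b::field"
  assumes h: "ring_embedding h"
begin

interpretation ring_embedding h by (fact h)

lemma adjoin_mem: "poly (map_poly h p) x \<in> adjoin h x"
  by (simp add: adjoin_def)

lemma adjoin_base: "h c \<in> adjoin h x"
  using adjoin_mem[of "[:c:]" x] by (simp add: map_poly_hom_pCons)

lemma adjoin_generator: "x \<in> adjoin h x"
  using adjoin_mem[of "[:0, 1:]" x] by (simp add: map_poly_hom_pCons hom_zero hom_one)

lemma adjoin_subfield:
  assumes "p \<noteq> 0" "poly (map_poly h p) x = 0"
  shows "is_subfield (adjoin h x)"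
proof -
  obtain m where m: "poly (map_poly h m) x = 0" "prime_elem m"
    "\<And>q. poly (map_poly h q) x = 0 \<Longrightarrow> m dvd q"
    using minimal_polynomial[OF h assms] by metis
  have "1 \<in> adjoin h x"
    using adjoin_base[of 1 x] by (simp add: hom_one)
  moreover have "u - v \<in> adjoin h x \<and> u * v \<in> adjoin h x" if uv: "u \<in> adjoin h x" "v \<in> adjoin h x" for u v
  proof -
    obtain p q where "u = poly (map_poly h p) x" "v = poly (map_poly h q) x"
      using uv by (auto simp: adjoin_def)
    thus ?thesis
      using adjoin_mem[of "p - q" x] adjoin_mem[of "p * q" x]
      by (simp add: map_poly_hom_diff map_poly_hom_mult)
  qed
  moreover have "inverse u \<in> adjoin h x" if u: "u \<in> adjoin h x" for u
  proof -
    obtain p where p: "u = poly (map_poly h p) x"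
      using u by (auto simp: adjoin_def)
    show ?thesis
    proof (cases "u = 0")
      case True
      thus ?thesis using adjoin_base[of 0 x] by (simp add: hom_zero)
    next
      case False
      have "\<not> m dvd p"
        using False m(1) p by (auto simp: map_poly_hom_mult elim!: dvdE)
      then obtain a b where "a * m + b * p = 1"
        using irreducible_bezout[OF prime_elem_imp_irreducible[OF m(2)]] by blast
      hence "poly (map_poly h (a * m + b * p)) x = 1"
        by (simp add: hom_one)
      hence "poly (map_poly h b) x * u = 1"
        using m(1) p by (simp add: map_poly_hom_add map_poly_hom_mult)
      hence "inverse u = poly (map_poly h b) x"
        using inverse_unique[of u "poly (map_poly h b) x"] by (simp add: mult.commute)
      thus ?thesis using adjoin_mem by simp
    qed
  qed
  ultimately show ?thesis
    by (auto simp: is_subfield_def)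
qed

lemma adjoin_mono:
  assumes "is_subfield S" "range h \<subseteq> S" "x \<in> S"
  shows "adjoin h x \<subseteq> S"
proof -
  have "map_poly h p \<in> polys_over S" for p
    using assms(2) by (auto simp: polys_over_def coeff_map_poly_hom)
  thus ?thesis
    using is_subfield_poly[OF assms(1) _ assms(3)] by (auto simp: adjoin_def)
qed

end

text \<open>
  Separability in characteristic \<open>0\<close>: a double root of \<open>m\<close> would be a root of the derivative, which is
  nonzero and of smaller degree.
\<close>
lemma simple_root_of_minimal_polynomial:
  fixes h :: "'a::field_char_0 \<Rightarrow> 'b::field"
  assumes h: "ring_embedding h" and m: "lead_coeff m = 1" "poly (map_poly h m) x = 0"
    and min: "\<And>q. poly (map_poly h q) x = 0 \<Longrightarrow> m dvd q"
  shows "\<not> [:- x, 1:] ^ 2 dvd map_poly h m"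
proof
  interpret ring_embedding h by fact
  assume "[:- x, 1:] ^ 2 dvd map_poly h m"
  then obtain r where "map_poly h m = [:- x, 1:] ^ 2 * r"
    by (rule dvdE)
  hence r: "map_poly h m = [:- x, 1:] * ([:- x, 1:] * r)"
    by (simp only: power2_eq_square mult.assoc)
  have "poly (pderiv ([:- x, 1:] * ([:- x, 1:] * r))) x = 0"
    by (simp only: pderiv_mult poly_add poly_mult) simp
  hence "poly (map_poly h (pderiv m)) x = 0"
    by (simp only: map_poly_hom_pderiv r)
  hence "m dvd pderiv m"
    by (rule min)
  moreover have "degree m \<noteq> 0"
  proof
    assume "degree m = 0"
    then obtain c where "m = [:c:]" by (rule degree_eq_zeroE)
    with m show False by (simp add: map_poly_hom_pCons hom_one)
  qed
  ultimately show False
    using dvd_imp_degree_le[of m "pderiv m"] degree_pderiv[of m] pderiv_eq_0_iff[of m] by auto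
qed

text \<open>
  The classical argument.  For \<open>t = a + c b\<close> the element \<open>b\<close> is a root of its minimal polynomial \<open>g\<close>
  over \<open>k\<close> and of \<open>f(t - c x)\<close>, which is over \<open>k(t)\<close>.  For all but finitely many \<open>c\<close> it is their only
  common root, and it is simple; so its minimal polynomial over \<open>k(t)\<close> is linear.
\<close>
lemma primitive_element:
  fixes a b :: "'a::field_char_0 alg_closure"
  obtains t where "a \<in> adjoin to_ac t" "b \<in> adjoin to_ac t"
proof -
  note e = to_ac_embedding
  interpret ring_embedding "to_ac :: 'a \<Rightarrow> _" by (fact e)
  obtain f where f: "f \<noteq> 0" "poly (map_poly to_ac f) a = 0"
    by (rule alg_closure_algebraic)
  obtain g0 where "g0 \<noteq> 0" "poly (map_poly to_ac g0) b = 0"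
    by (rule alg_closure_algebraic)
  then obtain g where g: "poly (map_poly to_ac g) b = 0" "lead_coeff g = 1"
    and g_min: "\<And>q. poly (map_poly to_ac q) b = 0 \<Longrightarrow> g dvd q"
    using minimal_polynomial[OF e] by metis
  have g_simple: "\<not> [:- b, 1:] ^ 2 dvd map_poly to_ac g"
    by (rule simple_root_of_minimal_polynomial[OF e g(2,1) g_min])
  define A where "A = {x. poly (map_poly to_ac f) x = 0}"
  define B where "B = {x. poly (map_poly to_ac g) x = 0}"
  have "finite A" "finite B"
    unfolding A_def B_def using f(1) g(2)
    by (auto intro!: poly_roots_finite simp: map_poly_hom_eq_0_iff)
  hence "finite ((\<lambda>(x, y). (x - a) / (b - y)) ` (A \<times> B))"
    by blast
  moreover have "infinite (range (to_ac :: 'a \<Rightarrow> _))"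
    using range_inj_infinite[of "to_ac \<circ> (of_nat :: nat \<Rightarrow> 'a)"]
    by (metis finite_imageD infinite_UNIV_char_0 inj_to_ac)
  \<comment> \<open>The excluded values of \<open>c\<close> are those for which a further common root \<open>y\<close> can exist, with
    \<open>x = t - c y\<close> a root of \<open>f\<close>.\<close>
  ultimately obtain c :: 'a where c: "to_ac c \<notin> (\<lambda>(x, y). (x - a) / (b - y)) ` (A \<times> B)"
    by (meson finite_subset image_subset_iff)
  define t where "t = a + to_ac c * b"
  define S where "S = adjoin to_ac t"
  obtain p :: "'a poly" where "p \<noteq> 0" "poly (map_poly to_ac p) t = 0"
    by (rule alg_closure_algebraic)
  hence S: "is_subfield S"
    unfolding S_def by (rule adjoin_subfield[OF e])
  have base: "to_ac x \<in> S" for x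
    unfolding S_def by (rule adjoin_base[OF e])
  have t: "t \<in> S"
    unfolding S_def by (rule adjoin_generator[OF e])
  have map: "map_poly to_ac q \<in> polys_over S" for q
    using base by (auto simp: polys_over_def coeff_map_poly_hom)
  define H where "H = pcompose (map_poly to_ac f) [:t, - to_ac c:]"
  have H: "H \<in> polys_over S"
    unfolding H_def using t base
    by (intro polys_over_pcompose[OF S] map polys_over_closed[OF S] is_subfieldD[OF S])
  have H_b: "poly H b = 0"
    using f(2) by (simp add: H_def poly_pcompose t_def mult.commute)
  have "map_poly to_ac g \<noteq> 0"
    using g(2) by (auto simp: map_poly_hom_eq_0_iff)
  then obtain m where m: "m \<in> polys_over S" "poly m b = 0" "lead_coeff m = 1"
    and m_min: "\<And>q. q \<in> polys_over S \<Longrightarrow> poly q b = 0 \<Longrightarrow> m dvd q"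
    using minimal_polynomial_over[OF S map _ g(1)] by metis
  have m_H: "m dvd H" and m_g: "m dvd map_poly to_ac g"
    using m_min H H_b map g(1) by blast+
  have root: "x = b" if "poly m x = 0" for x
  proof (rule ccontr)
    assume "x \<noteq> b"
    have "x \<in> B"
      using m_g that by (auto simp: B_def elim!: dvdE)
    moreover have "t - to_ac c * x \<in> A"
    proof -
      have "poly H x = 0"
        using m_H that by (auto elim!: dvdE)
      thus ?thesis
        by (simp add: A_def H_def poly_pcompose mult.commute)
    qed
    moreover have "to_ac c = (t - to_ac c * x - a) / (b - x)"
      using \<open>x \<noteq> b\<close> by (simp add: t_def field_simps)
    ultimately show False
      using c by force
  qed
  obtain q where q: "m = [:- b, 1:] * q"
    using m(2) by (auto simp: poly_eq_0_iff_dvd elim: dvdE)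
  have "degree q = 0"
  proof (rule ccontr)
    assume "degree q \<noteq> 0"
    then obtain r where r: "poly q r = 0"
      using alg_closed_imp_poly_has_root[of q] by auto
    hence "r = b"
      using root[of r] q by simp
    with r have "[:- b, 1:] dvd q"
      by (simp add: poly_eq_0_iff_dvd)
    hence "[:- b, 1:] ^ 2 dvd m"
      unfolding q power2_eq_square by (intro mult_dvd_mono) auto
    with m_g g_simple show False
      using dvd_trans by blast
  qed
  then obtain u where "q = [:u:]"
    by (rule degree_eq_zeroE)
  with m(3) q have "m = [:- b, 1:]"
    by (auto split: if_splits)
  hence "- b \<in> S"
    using polys_over_coeff[OF m(1), of 0] by simp
  hence b: "b \<in> S"
    using is_subfieldD(8)[OF S, of "- b"] by simp
  have "a = t - to_ac c * b"
    by (simp add: t_def)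
  hence "a \<in> S"
    using b t base by (auto intro!: is_subfieldD[OF S])
  with b show ?thesis
    using that[of t] by (simp add: S_def)
qed

lemma primitive_element_finite:
  fixes C :: "'a::field_char_0 alg_closure set"
  assumes "finite C"
  obtains t where "C \<subseteq> adjoin to_ac t"
  using assms
proof (induction C arbitrary: thesis)
  case (insert a C)
  obtain t where t: "C \<subseteq> adjoin to_ac t"
    using insert.IH by blast
  obtain u where u: "a \<in> adjoin to_ac u" "t \<in> adjoin to_ac u"
    by (rule primitive_element)
  obtain p :: "'a poly" where "p \<noteq> 0" "poly (map_poly to_ac p) u = 0"
    by (rule alg_closure_algebraic)
  hence "adjoin to_ac t \<subseteq> adjoin to_ac u"
    using u(2) by (intro adjoin_mono to_ac_embedding adjoin_subfield)
      (auto intro: adjoin_base[OF to_ac_embedding])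
  thus ?case
    using insert.prems[of u] t u(1) by blast
qed simp

section \<open>Polynomials with constant coefficients\<close>

text \<open>
  Over the field \<open>'b\<close> the polynomial \<open>g\<close> is a product of linear factors with roots in the image of
  \<open>h\<close>, so each monic divisor is a product of some of these factors.
\<close>
lemma monic_divisor_of_split_poly:
  fixes h :: "'a::alg_closed_field \<Rightarrow> 'b::field"
  assumes "ring_embedding h" "g \<noteq> 0" "m dvd map_poly h g" "lead_coeff m = 1"
  obtains m' where "m = map_poly h m'"
proof -
  interpret ring_embedding h by fact
  have "\<exists>m'. m = map_poly h m'"
    using assms(2-4)
  proof (induction "degree g" arbitrary: g m rule: less_induct)
    case less
    show ?case
    proof (cases "degree g = 0")
      case True
      then obtain c where "g = [:c:]" "c \<noteq> 0"
        using less.prems(1) by (auto elim: degree_eq_zeroE)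
      hence "degree m = 0"
        using dvd_imp_degree_le[OF less.prems(2)] by (simp add: map_poly_hom_pCons hom_eq_0_iff)
      hence "m = 1"
        using less.prems(3) by (metis degree_eq_zeroE lead_coeff_pCons(2) one_pCons)
      thus ?thesis
        by (metis hom_one map_poly_1')
    next
      case False
      then obtain a where "poly g a = 0"
        using alg_closed_imp_poly_has_root[of g] by auto
      then obtain g' where g': "g = [:- a, 1:] * g'"
        by (auto simp: poly_eq_0_iff_dvd elim: dvdE)
      have [simp]: "g' \<noteq> 0"
        using g' less.prems(1) by auto
      have deg: "degree g' < degree g"
        unfolding g' by (subst degree_mult_eq) auto
      define l where "l = [:- h a, 1:]"
      have map: "map_poly h g = l * map_poly h g'"
        unfolding g' map_poly_hom_mult
        by (simp add: map_poly_hom_pCons hom_uminus hom_one l_def)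
      have l: "prime_elem l" "l \<noteq> 0" "lead_coeff l = 1"
        by (auto simp: l_def intro: prime_elem_linear_field_poly)
      show ?thesis
      proof (cases "l dvd m")
        case True
        then obtain m1 where m1: "m = l * m1" by (auto elim: dvdE)
        have "m1 dvd map_poly h g'"
          using less.prems(2) l(2) unfolding map m1 by simp
        moreover have "lead_coeff m1 = 1"
          using less.prems(3) l(3) unfolding m1 lead_coeff_mult by simp
        ultimately obtain m1' where "m1 = map_poly h m1'"
          using less.hyps[OF deg] by auto
        hence "m = map_poly h ([:- a, 1:] * m1')"
          unfolding m1 map_poly_hom_mult
          by (simp add: map_poly_hom_pCons hom_uminus hom_one l_def)
        thus ?thesis by blast
      next
        case False
        obtain k where k: "l * map_poly h g' = m * k"
          using less.prems(2) unfolding map by (auto elim: dvdE)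
        hence "l dvd m * k" by (metis dvd_triv_left)
        hence "l dvd k"
          using False l(1) prime_elem_dvd_mult_iff by blast
        then obtain k' where "k = l * k'" by (auto elim: dvdE)
        with k have "l * map_poly h g' = l * (m * k')"
          by (simp add: mult_ac)
        hence "m dvd map_poly h g'"
          using l(2) by simp
        thus ?thesis
          using less.hyps[OF deg] less.prems(3) by auto
      qed
    qed
  qed
  thus ?thesis using that by blast
qed

text \<open>
  A prime that divides \<open>p(g)\<close> divides one of the factors \<open>g - a\<close> into which \<open>p(g)\<close> splits.
\<close>
lemma prime_dvd_split_poly:
  fixes h :: "'a::alg_closed_field \<Rightarrow> 'b::field"
  assumes "ring_embedding h" "prime_elem q" "p \<noteq> 0" "q dvd pcompose (map_poly h p) g"
  obtains a where "q dvd g - [:h a:]"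
proof -
  interpret ring_embedding h by fact
  have "\<exists>a. q dvd g - [:h a:]"
    using assms(3-4)
  proof (induction "degree p" arbitrary: p rule: less_induct)
    case less
    show ?case
    proof (cases "degree p = 0")
      case True
      then obtain c where c: "p = [:c:]" "c \<noteq> 0"
        using less.prems(1) by (auto elim: degree_eq_zeroE)
      hence "q dvd [:h c:]"
        using less.prems(2) by (simp add: map_poly_hom_pCons)
      moreover have "is_unit [:h c:]"
        using c(2) by (simp add: is_unit_const_poly_iff dvd_field_iff hom_eq_0_iff)
      ultimately show ?thesis
        using assms(2) dvd_trans prime_elem_not_unit by blast
    next
      case False
      then obtain a where "poly p a = 0"
        using alg_closed_imp_poly_has_root[of p] by auto
      then obtain p' where p': "p = [:- a, 1:] * p'"
        by (auto simp: poly_eq_0_iff_dvd elim: dvdE)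
      have [simp]: "p' \<noteq> 0"
        using p' less.prems(1) by auto
      have deg: "degree p' < degree p"
        unfolding p' by (subst degree_mult_eq) auto
      have "pcompose (map_poly h p) g = (g - [:h a:]) * pcompose (map_poly h p') g"
        unfolding p' map_poly_hom_mult pcompose_mult
        by (simp add: map_poly_hom_pCons pcompose_pCons hom_uminus hom_one)
      hence "q dvd g - [:h a:] \<or> q dvd pcompose (map_poly h p') g"
        using less.prems(2) prime_elem_dvd_mult_iff[OF assms(2)] by metis
      thus ?thesis
        using less.hyps[OF deg] by auto
    qed
  qed
  thus ?thesis using that by blast
qed

section \<open>Regularity and absolute irreducibility\<close>

definition const_fract :: "'a::idom \<Rightarrow> 'a poly fract" where
  "const_fract c = to_fract [:c:]"

text \<open>
  For irreducible \<open>F\<close>, this says that \<open>k\<close> is algebraically closed in \<open>k(X)[Y]/(F)\<close>, in terms of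
  representatives \<open>h\<close> of the elements of that field.
\<close>
definition regular_poly :: "'k::field poly poly \<Rightarrow> bool" where
  "regular_poly F \<longleftrightarrow>
     (\<forall>p h. p \<noteq> 0 \<and> over_kX F dvd pcompose (map_poly const_fract p) h \<longrightarrow>
        (\<exists>c. over_kX F dvd h - [:const_fract c:]))"

definition extend_constants :: "'k::field poly fract \<Rightarrow> 'k alg_closure poly fract" where
  "extend_constants = fract_map (map_poly to_ac)"

lemma const_fract_embedding: "ring_embedding (const_fract :: 'a::idom \<Rightarrow> _)"
  unfolding const_fract_def
  by (rule ring_embedding_compose[OF const_poly_embedding to_fract_embedding])

lemma poly_to_ac_embedding: "ring_embedding (map_poly (to_ac :: 'a::field \<Rightarrow> _))"
  by (rule ring_embedding.map_poly_embedding[OF to_ac_embedding])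

lemma extend_constants_embedding: "ring_embedding (extend_constants :: 'a::field poly fract \<Rightarrow> _)"
  unfolding extend_constants_def by (rule ring_embedding.fract_map_embedding[OF poly_to_ac_embedding])

lemma extend_constants_to_fract: "extend_constants (to_fract p) = to_fract (map_poly to_ac p)"
  unfolding extend_constants_def by (rule ring_embedding.fract_map_to_fract[OF poly_to_ac_embedding])

lemma extend_constants_const_fract: "extend_constants (const_fract c) = const_fract (to_ac c)"
  by (simp add: const_fract_def extend_constants_to_fract map_poly_pCons)

lemma extend_constants_over_kX: "map_poly extend_constants (over_kX f) = over_kX (over_closure f)"
  by (rule poly_eqI) (simp add: over_kX_def over_closure_def coeff_map_poly
      ring_embedding.hom_zero[OF extend_constants_embedding] extend_constants_to_fract)

lemma extend_constants_map_const_fract: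
  "map_poly extend_constants (map_poly const_fract p) = map_poly const_fract (map_poly to_ac p)"
  by (rule poly_eqI) (simp add: coeff_map_poly extend_constants_const_fract
      ring_embedding.hom_zero[OF extend_constants_embedding]
      ring_embedding.hom_zero[OF const_fract_embedding])

text \<open>
  Inside the function field over the closure, the only constants that come from \<open>k(X)\<close> are those
  of \<open>k\<close>: if \<open>u/v = \<alpha>\<close> then \<open>\<alpha>\<close> is a quotient of coefficients of \<open>u\<close> and \<open>v\<close>.
\<close>
lemma constant_descends:
  assumes "extend_constants a = const_fract \<alpha>"
  obtains c where "a = const_fract c" "\<alpha> = to_ac c"
proof -
  obtain u v where uv: "a = Fract u v" "v \<noteq> 0"
    by (cases a)
  interpret ring_embedding "to_ac :: 'a \<Rightarrow> _" by (rule to_ac_embedding)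
  have "Fract (map_poly to_ac u) (map_poly to_ac v) = Fract [:\<alpha>:] 1"
    using assms uv(2) unfolding uv(1) extend_constants_def const_fract_def to_fract_def
    by (simp add: ring_embedding.fract_map_Fract[OF poly_to_ac_embedding])
  hence eq: "map_poly to_ac u = Polynomial.smult \<alpha> (map_poly to_ac v)"
    using uv(2) by (simp add: eq_fract map_poly_hom_eq_0_iff)
  hence "to_ac (Polynomial.coeff u (degree v)) = \<alpha> * to_ac (lead_coeff v)"
    by (metis coeff_map_poly_hom coeff_smult)
  hence \<alpha>: "\<alpha> = to_ac (Polynomial.coeff u (degree v) / lead_coeff v)"
    using uv(2) by (simp add: field_simps)
  hence "extend_constants a = extend_constants (const_fract (Polynomial.coeff u (degree v) / lead_coeff v))"
    by (simp only: assms extend_constants_const_fract)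
  hence "a = const_fract (Polynomial.coeff u (degree v) / lead_coeff v)"
    by (simp only: ring_embedding.hom_eq_iff[OF extend_constants_embedding])
  thus ?thesis using \<alpha> that by blast
qed

lemma degree_over_kX: "degree (over_kX f) = degree f"
  unfolding over_kX_def by (rule ring_embedding.degree_map_poly_hom[OF to_fract_embedding])

lemma lead_coeff_over_closure: "lead_coeff (over_closure f) = map_poly to_ac (lead_coeff f)"
  unfolding over_closure_def by (rule ring_embedding.lead_coeff_map_poly_hom[OF poly_to_ac_embedding])

lemma degree_over_closure: "degree (over_closure f) = degree f"
  unfolding over_closure_def by (rule ring_embedding.degree_map_poly_hom[OF poly_to_ac_embedding])

text \<open>
  Gauss's lemma; a monic polynomial has content \<open>1\<close>.
\<close>
lemma irreducible_over_closure_iff: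
  assumes "lead_coeff F = 1" "degree F > 0"
  shows "Factorial_Ring.irreducible (over_closure F) \<longleftrightarrow>
    Factorial_Ring.irreducible (over_kX (over_closure F))"
proof -
  have "content (over_closure F) dvd lead_coeff (over_closure F)"
    by (rule content_dvd_coeff)
  hence "content (over_closure F) = 1"
    using assms(1) by (simp add: lead_coeff_over_closure is_unit_content_iff)
  thus ?thesis
    using nonconst_poly_irreducible_iff[of "over_closure F"] assms(2)
    by (simp add: degree_over_closure over_kX_def)
qed

text \<open>
  Over the closure \<open>p\<close> splits, so the prime \<open>F\<close> divides some \<open>h - \<alpha>\<close>.  Replacing \<open>h\<close> by its remainder
  modulo \<open>F\<close> forces \<open>h = \<alpha>\<close> for degree reasons.
\<close>
lemma regular_poly_if_irreducible_over_closure: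
  assumes F: "lead_coeff F = 1" "degree F > 0"
    and irr: "Factorial_Ring.irreducible (over_closure F)"
  shows "regular_poly F"
  unfolding regular_poly_def
proof (intro allI impI, elim conjE)
  fix p h
  assume p: "p \<noteq> 0" and dvd: "over_kX F dvd pcompose (map_poly const_fract p) h"
  interpret ext: ring_embedding "extend_constants :: 'a poly fract \<Rightarrow> _"
    by (rule extend_constants_embedding)
  define Fb where "Fb = over_kX (over_closure F)"
  have deg: "degree Fb = degree (over_kX F)" "degree Fb > 0"
    using F by (simp_all add: Fb_def degree_over_kX degree_over_closure)
  have "prime_elem Fb"
    using irr F unfolding Fb_def
    by (simp add: irreducible_over_closure_iff field_poly_irreducible_imp_prime)
  moreover have "Fb dvd pcompose (map_poly const_fract (map_poly to_ac p)) (map_poly extend_constants h)"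
    using ext.map_poly_hom_dvd[OF dvd]
    by (simp add: Fb_def extend_constants_over_kX ext.map_poly_hom_pcompose
        extend_constants_map_const_fract)
  moreover have "map_poly to_ac p \<noteq> 0"
    using p by (simp add: ring_embedding.map_poly_hom_eq_0_iff[OF to_ac_embedding])
  ultimately obtain \<alpha> where \<alpha>: "Fb dvd map_poly extend_constants h - [:const_fract \<alpha>:]"
    using prime_dvd_split_poly[OF const_fract_embedding] by metis
  \<comment> \<open>The remainder is taken over \<open>k(X)\<close>, so that \<open>\<alpha>\<close> turns out to come from \<open>k(X)\<close>.\<close>
  define r where "r = h mod over_kX F"
  have h_r: "over_kX F dvd h - r"
    by (simp add: r_def minus_mod_eq_mult_div)
  have "over_kX F \<noteq> 0" using deg by auto
  hence deg_r: "degree r < degree Fb"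
    using degree_mod_less[of "over_kX F" h] deg by (auto simp: r_def)
  have "Fb dvd map_poly extend_constants r - [:const_fract \<alpha>:]"
  proof -
    have "Fb dvd map_poly extend_constants (h - r)"
      using ext.map_poly_hom_dvd[OF h_r] by (simp add: Fb_def extend_constants_over_kX)
    moreover have "map_poly extend_constants r - [:const_fract \<alpha>:] =
        map_poly extend_constants h - [:const_fract \<alpha>:] - map_poly extend_constants (h - r)"
      by (simp add: ext.map_poly_hom_diff)
    ultimately show ?thesis
      using \<alpha> by (metis dvd_diff)
  qed
  moreover have "degree (map_poly extend_constants r - [:const_fract \<alpha>:]) < degree Fb"
    using deg_r deg by (intro degree_diff_less) (simp_all add: ext.degree_map_poly_hom)
  ultimately have "map_poly extend_constants r - [:const_fract \<alpha>:] = 0"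
    using dvd_imp_degree_le leD by blast
  hence r: "map_poly extend_constants r = [:const_fract \<alpha>:]"
    by simp
  hence "degree r = 0"
    using ext.degree_map_poly_hom[of r] by simp
  then obtain a where a: "r = [:a:]"
    by (rule degree_eq_zeroE)
  with r have "extend_constants a = const_fract \<alpha>"
    by (simp add: ext.map_poly_hom_pCons)
  then obtain c where "a = const_fract c"
    by (rule constant_descends)
  thus "\<exists>c. over_kX F dvd h - [:const_fract c:]"
    using h_r a by auto
qed

text \<open>
  The leading coefficients of the two factors are inverse to each other, so they can be moved across
  to make the first factor monic; a factor of degree \<open>0\<close> would then be a unit.
\<close>
lemma monic_factorization:
  fixes f :: "'a::idom poly"
  assumes "lead_coeff f = 1" "\<not> Factorial_Ring.irreducible f" "degree f > 0"
  obtains f1 f2 where "f = f1 * f2" "lead_coeff f1 = 1" "0 < degree f1" "degree f1 < degree f"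
proof -
  have "f \<noteq> 0" using assms(1) by auto
  moreover have "\<not> f dvd 1"
    using assms(3) by (auto simp: is_unit_poly_iff)
  ultimately obtain a b where ab: "f = a * b" "\<not> a dvd 1" "\<not> b dvd 1"
    using assms(2) by (auto simp: Factorial_Ring.irreducible_def)
  have lc: "lead_coeff a * lead_coeff b = 1"
    using assms(1) ab(1) by (simp add: lead_coeff_mult)
  have pos: "degree p > 0" if "\<not> p dvd 1" "lead_coeff p dvd 1" for p :: "'a poly"
    using that by (cases "degree p = 0") (auto simp: is_unit_const_poly_iff elim: degree_eq_zeroE)
  have deg: "degree a > 0" "degree b > 0"
    using ab(2,3) lc by (metis dvd_triv_left pos, metis dvd_triv_right pos)
  show ?thesis
  proof (rule that[of "Polynomial.smult (lead_coeff b) a" "Polynomial.smult (lead_coeff a) b"])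
    show "f = Polynomial.smult (lead_coeff b) a * Polynomial.smult (lead_coeff a) b"
      using ab(1) lc by (simp add: mult.commute)
    show "lead_coeff (Polynomial.smult (lead_coeff b) a) = 1"
      using lc unfolding lead_coeff_smult by (simp only: mult.commute)
    have "lead_coeff b \<noteq> 0" using lc by (metis mult_zero_right zero_neq_one)
    thus "0 < degree (Polynomial.smult (lead_coeff b) a)" using deg by simp
    have "degree f = degree a + degree b"
      using ab(1) \<open>f \<noteq> 0\<close> by (simp add: degree_mult_eq)
    thus "degree (Polynomial.smult (lead_coeff b) a) < degree f"
      using \<open>lead_coeff b \<noteq> 0\<close> deg by simp
  qed
qed

text \<open>
  A proper factor \<open>f1\<close> of \<open>F\<close> over the closure, evaluated at one of its roots \<open>y\<close>, is a relation for a
  primitive element \<open>\<theta>\<close> of its coefficient field over \<open>k(X)(y)\<close>, of degree less than the degree \<open>d\<close> of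
  \<open>\<theta>\<close> over \<open>k\<close>.  Regularity excludes this, because it keeps the minimal polynomial of \<open>\<theta>\<close> from
  dropping in degree when \<open>k\<close> is replaced by \<open>k(X)(y)\<close>.
\<close>
lemma irreducible_over_closure_if_regular_poly:
  fixes F :: "'k::field_char_0 poly poly"
  assumes F: "lead_coeff F = 1" "degree F > 0"
    and irr: "Factorial_Ring.irreducible (over_kX F)" and reg: "regular_poly F"
  shows "Factorial_Ring.irreducible (over_closure F)"
proof (rule ccontr)
  assume "\<not> Factorial_Ring.irreducible (over_closure F)"
  moreover have "lead_coeff (over_closure F) = 1"
    unfolding lead_coeff_over_closure F by simp
  ultimately obtain f1 f2 where f: "over_closure F = f1 * f2" and f1: "lead_coeff f1 = 1"
    "0 < degree f1" "degree f1 < degree F"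
    using monic_factorization[of "over_closure F"] F(2) unfolding degree_over_closure by metis
  \<comment> \<open>Everything is compared in an algebraic closure of the function field over the closure of \<open>k\<close>:
    \<open>\<sigma>\<close>, \<open>\<kappa>\<close> and \<open>\<iota>\<close> embed the polynomials in \<open>X\<close>, the constants, and \<open>k(X)\<close>.\<close>
  define \<sigma> :: "'k alg_closure poly \<Rightarrow> 'k alg_closure poly fract alg_closure"
    where "\<sigma> = (\<lambda>p. to_ac (to_fract p))"
  define \<kappa> :: "'k alg_closure \<Rightarrow> 'k alg_closure poly fract alg_closure"
    where "\<kappa> = (\<lambda>c. to_ac (const_fract c))"
  define \<iota> :: "'k poly fract \<Rightarrow> 'k alg_closure poly fract alg_closure"
    where "\<iota> = (\<lambda>a. to_ac (extend_constants a))"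
  have \<sigma>: "ring_embedding \<sigma>"
    unfolding \<sigma>_def by (rule ring_embedding_compose[OF to_fract_embedding to_ac_embedding])
  have \<kappa>: "ring_embedding \<kappa>"
    unfolding \<kappa>_def by (rule ring_embedding_compose[OF const_fract_embedding to_ac_embedding])
  have \<iota>: "ring_embedding \<iota>"
    unfolding \<iota>_def by (rule ring_embedding_compose[OF extend_constants_embedding to_ac_embedding])
  interpret \<sigma>: ring_embedding \<sigma> by (fact \<sigma>)
  interpret \<kappa>: ring_embedding \<kappa> by (fact \<kappa>)
  interpret \<iota>: ring_embedding \<iota> by (fact \<iota>)
  interpret ac: ring_embedding "to_ac :: 'k \<Rightarrow> _" by (rule to_ac_embedding)
  have \<iota>_const: "\<iota> (const_fract c) = \<kappa> (to_ac c)" for c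
    by (simp add: \<iota>_def \<kappa>_def extend_constants_const_fract)

  obtain y where y: "poly (map_poly \<sigma> f1) y = 0"
    using alg_closed_imp_poly_has_root[of "map_poly \<sigma> f1"] f1(2)
    by (auto simp: \<sigma>.degree_map_poly_hom)
  define ev where "ev = (\<lambda>f. poly (map_poly \<sigma> f) y)"
  have ev_closure: "ev (over_closure f) = poly (map_poly \<iota> (over_kX f)) y" for f
  proof -
    have "map_poly \<iota> (over_kX f) = map_poly to_ac (map_poly extend_constants (over_kX f))"
      unfolding \<iota>_def
      by (rule map_poly_embedding_compose[OF extend_constants_embedding to_ac_embedding, symmetric])
    also have "\<dots> = map_poly \<sigma> (over_closure f)"
      unfolding \<sigma>_def extend_constants_over_kX unfolding over_kX_def
      by (rule map_poly_embedding_compose[OF to_fract_embedding to_ac_embedding])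
    finally show ?thesis by (simp add: ev_def)
  qed
  have y_F: "poly (map_poly \<iota> (over_kX F)) y = 0"
    using y unfolding ev_closure[symmetric] by (simp add: f ev_def \<sigma>.map_poly_hom_mult)
  have F_dvd: "over_kX F dvd q" if "poly (map_poly \<iota> q) y = 0" for q
    by (rule irreducible_dvd_of_common_root[OF \<iota> irr y_F that])
  define L where "L = adjoin \<iota> y"
  have "over_kX F \<noteq> 0" using irr by auto
  hence L: "is_subfield L"
    unfolding L_def using y_F by (rule adjoin_subfield[OF \<iota>])
  \<comment> \<open>Regularity, in the form in which it is used: constants in \<open>L = k(X)(y)\<close> are in \<open>k\<close>.\<close>
  have L_constants: "\<exists>c. \<alpha> = to_ac c" if mem: "\<kappa> \<alpha> \<in> L" for \<alpha>
  proof -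
    obtain h where "\<kappa> \<alpha> = poly (map_poly \<iota> h) y"
      using mem unfolding L_def adjoin_def by (rule imageE)
    hence h: "poly (map_poly \<iota> h) y = \<kappa> \<alpha>" ..
    obtain p where p: "p \<noteq> 0" "poly (map_poly to_ac p) \<alpha> = 0"
      by (rule alg_closure_algebraic)
    have "map_poly \<iota> (map_poly const_fract p) = map_poly \<kappa> (map_poly to_ac p)"
      unfolding map_poly_embedding_compose[OF to_ac_embedding \<kappa>]
        map_poly_embedding_compose[OF const_fract_embedding \<iota>] \<iota>_const ..
    hence "poly (map_poly \<iota> (pcompose (map_poly const_fract p) h)) y = \<kappa> (poly (map_poly to_ac p) \<alpha>)"
      by (simp add: \<iota>.map_poly_hom_pcompose poly_pcompose h \<kappa>.poly_map_poly_hom)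
    hence "over_kX F dvd pcompose (map_poly const_fract p) h"
      by (intro F_dvd) (simp add: p \<kappa>.hom_zero)
    then obtain c where "over_kX F dvd h - [:const_fract c:]"
      using reg p(1) unfolding regular_poly_def by blast
    then obtain k where "h - [:const_fract c:] = over_kX F * k"
      by (rule dvdE)
    hence "h = over_kX F * k + [:const_fract c:]"
      by (simp add: algebra_simps)
    hence "\<kappa> \<alpha> = \<kappa> (to_ac c)"
      using h y_F by (simp add: \<iota>.map_poly_hom_add \<iota>.map_poly_hom_mult \<iota>.map_poly_hom_pCons \<iota>_const)
    thus ?thesis by (auto simp: \<kappa>.hom_eq_iff)
  qed

  define C where "C = (\<Union>p\<in>range (Polynomial.coeff f1). range (Polynomial.coeff p))"
  have fin: "finite (range (Polynomial.coeff p))" for p :: "'b::zero poly"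
  proof (rule finite_subset)
    show "range (Polynomial.coeff p) \<subseteq> insert 0 (Polynomial.coeff p ` {..degree p})"
      by (auto simp: not_le intro: coeff_eq_0 rev_image_eqI) (metis atMost_iff coeff_eq_0 image_eqI linorder_not_le)
  qed simp
  have "finite C"
    unfolding C_def by (intro finite_UN_I fin)
  then obtain \<theta> where \<theta>: "C \<subseteq> adjoin to_ac \<theta>"
    by (rule primitive_element_finite)
  obtain g0 where "g0 \<noteq> 0" "poly (map_poly to_ac g0) \<theta> = 0"
    by (rule alg_closure_algebraic)
  then obtain g where g: "poly (map_poly to_ac g) \<theta> = 0" "lead_coeff g = 1"
    and g_min: "\<And>q. poly (map_poly to_ac q) \<theta> = 0 \<Longrightarrow> g dvd q"
    using minimal_polynomial[OF to_ac_embedding] by metis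
  define d where "d = degree g"
  have d: "d > 0"
  proof (rule ccontr)
    assume "\<not> d > 0"
    then obtain c where "g = [:c:]"
      unfolding d_def by (auto elim: degree_eq_zeroE)
    with g show False by (simp add: ac.map_poly_hom_pCons)
  qed
  have "g \<noteq> 0" using g(2) by auto
  have small: "q = 0" if "poly (map_poly to_ac q) \<theta> = 0" "degree q < d" for q
    using dvd_imp_degree_le[OF g_min[OF that(1)]] that(2) unfolding d_def by linarith

  \<comment> \<open>Elements of \<open>k(\<theta>)\<close> have a unique representation as a polynomial in \<open>\<theta>\<close> of degree less than \<open>d\<close>;
    uniqueness gives the values at \<open>0\<close> and \<open>1\<close>, so \<open>\<phi> 0\<close> below has the leading term of \<open>f1\<close>.\<close>
  define is_rep where "is_rep = (\<lambda>c q. poly (map_poly to_ac q) \<theta> = c \<and> degree q < d)"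
  define rep where "rep = (\<lambda>c. SOME q. is_rep c q)"
  have ex_rep: "\<exists>q. is_rep c q" if mem: "c \<in> adjoin to_ac \<theta>" for c
  proof -
    obtain q where q: "c = poly (map_poly to_ac q) \<theta>"
      using mem unfolding adjoin_def by (rule imageE)
    have "q = g * (q div g) + q mod g" by simp
    hence "c = poly (map_poly to_ac (q mod g)) \<theta>"
      using q g(1) by (metis ac.map_poly_hom_add ac.map_poly_hom_mult add_0 mult_zero_left poly_add poly_mult)
    moreover have "degree (q mod g) < d"
      using degree_mod_less[OF \<open>g \<noteq> 0\<close>, of q] d by (auto simp: d_def)
    ultimately show ?thesis by (auto simp: is_rep_def)
  qed
  have rep: "is_rep c (rep c)" if "c \<in> adjoin to_ac \<theta>" for c
    unfolding rep_def using ex_rep[OF that] by (rule someI_ex)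
  have rep_eqI: "rep c = q" if "is_rep c q" for c q
  proof -
    have "is_rep c (rep c)"
      unfolding rep_def using that by (rule someI)
    hence "rep c - q = 0"
      using that by (intro small) (auto simp: is_rep_def ac.map_poly_hom_diff intro: degree_diff_less)
    thus ?thesis by simp
  qed
  have rep_0: "rep 0 = 0" and rep_1: "rep 1 = 1"
    using d by (auto intro!: rep_eqI simp: is_rep_def)
  define \<phi> where "\<phi> = (\<lambda>j. map_poly (map_poly (\<lambda>c. Polynomial.coeff (rep c) j)) f1)"
  have coeff_\<phi>: "Polynomial.coeff (Polynomial.coeff (\<phi> j) l) n =
      Polynomial.coeff (rep (Polynomial.coeff (Polynomial.coeff f1 l) n)) j" for j l n
    by (simp add: \<phi>_def coeff_map_poly rep_0)
  have f1_eq: "f1 = (\<Sum>j<d. [:[:\<theta> ^ j:]:] * over_closure (\<phi> j))"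
  proof (rule poly_eqI, rule poly_eqI)
    fix l n
    define c where "c = Polynomial.coeff (Polynomial.coeff f1 l) n"
    have "c \<in> C" by (auto simp: C_def c_def)
    hence "is_rep c (rep c)"
      using \<theta> by (intro rep) auto
    hence r: "poly (map_poly to_ac (rep c)) \<theta> = c" "degree (rep c) < d"
      by (simp_all add: is_rep_def)
    have "c = (\<Sum>j\<le>degree (rep c). to_ac (Polynomial.coeff (rep c) j) * \<theta> ^ j)"
      using r(1) by (simp add: poly_altdef ac.degree_map_poly_hom ac.coeff_map_poly_hom)
    also have "\<dots> = (\<Sum>j<d. to_ac (Polynomial.coeff (rep c) j) * \<theta> ^ j)"
      using r(2) by (intro sum.mono_neutral_left) (auto simp: coeff_eq_0)
    finally show "Polynomial.coeff (Polynomial.coeff f1 l) n =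
        Polynomial.coeff (Polynomial.coeff (\<Sum>j<d. [:[:\<theta> ^ j:]:] * over_closure (\<phi> j)) l) n"
      by (simp add: coeff_sum over_closure_def coeff_map_poly coeff_\<phi> mult.commute flip: c_def)
  qed
  \<comment> \<open>\<open>f1(y) = 0\<close> read as an equation for \<open>\<theta>\<close> over \<open>L\<close>, of degree less than \<open>d\<close>.\<close>
  define R where "R = (\<Sum>j<d. Polynomial.monom (ev (over_closure (\<phi> j))) j)"
  have coeff_R: "Polynomial.coeff R i = (if i < d then ev (over_closure (\<phi> i)) else 0)" for i
    by (simp add: R_def coeff_sum)
  have R_L: "R \<in> polys_over L"
    unfolding R_def ev_closure L_def[symmetric]
    by (intro polys_over_sum[OF L] polys_over_closed[OF L]) (simp add: L_def adjoin_mem[OF \<iota>])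
  have R_root: "poly R (\<kappa> \<theta>) = 0"
  proof -
    have ev_term: "ev ([:[:\<theta> ^ j:]:] * over_closure (\<phi> j)) = \<kappa> \<theta> ^ j * ev (over_closure (\<phi> j))" for j
    proof -
      have "\<sigma> [:\<theta> ^ j:] = \<kappa> \<theta> ^ j"
        unfolding \<kappa>.hom_power[symmetric] by (simp add: \<sigma>_def \<kappa>_def const_fract_def)
      thus ?thesis
        unfolding ev_def \<sigma>.map_poly_hom_mult by (simp add: \<sigma>.map_poly_hom_pCons)
    qed
    have "ev f1 = (\<Sum>j<d. ev ([:[:\<theta> ^ j:]:] * over_closure (\<phi> j)))"
      unfolding ev_def
      by (subst f1_eq) (simp add: ring_embedding.hom_sum[OF \<sigma>.map_poly_embedding] poly_sum)
    also have "\<dots> = poly R (\<kappa> \<theta>)"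
      unfolding ev_term by (simp add: R_def poly_sum poly_monom mult.commute)
    finally show ?thesis
      using y by (simp add: ev_def)
  qed
  \<comment> \<open>The equation is nontrivial: \<open>y\<close> is no root of \<open>\<phi> 0\<close>, whose degree is below that of \<open>F\<close>.\<close>
  have "degree (\<phi> 0) \<le> degree f1"
    unfolding \<phi>_def by (rule map_poly_degree_leq)
  moreover have \<phi>_0: "\<phi> 0 \<noteq> 0"
  proof
    assume "\<phi> 0 = 0"
    with coeff_\<phi>[of 0 "degree f1" 0] f1(1) show False
      by (simp add: rep_1)
  qed
  ultimately have "\<not> over_kX F dvd over_kX (\<phi> 0)"
    using f1(3) dvd_imp_degree_le[of "over_kX F" "over_kX (\<phi> 0)"]
    by (auto simp: degree_over_kX) (auto simp: over_kX_def)
  hence "Polynomial.coeff R 0 \<noteq> 0"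
    using d F_dvd by (auto simp: coeff_R ev_closure)
  hence "R \<noteq> 0" by auto
  have "degree R < d"
    using d coeff_R by (metis \<open>R \<noteq> 0\<close> leading_coeff_0_iff)

  \<comment> \<open>The minimal polynomial of \<open>\<theta>\<close> over \<open>L\<close> divides the one over \<open>k\<close>, so its coefficients are
    constants in \<open>L\<close>, hence in \<open>k\<close>; but its degree is too small for that.\<close>
  obtain m where m: "m \<in> polys_over L" "poly m (\<kappa> \<theta>) = 0" "lead_coeff m = 1"
    and m_min: "\<And>q. q \<in> polys_over L \<Longrightarrow> poly q (\<kappa> \<theta>) = 0 \<Longrightarrow> m dvd q"
    using minimal_polynomial_over[OF L R_L \<open>R \<noteq> 0\<close> R_root] by metis
  have deg_m: "degree m < d"
    using dvd_imp_degree_le[OF m_min[OF R_L R_root] \<open>R \<noteq> 0\<close>] \<open>degree R < d\<close> by simp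
  have "m dvd map_poly \<kappa> (map_poly to_ac g)"
  proof (rule m_min)
    show "map_poly \<kappa> (map_poly to_ac g) \<in> polys_over L"
      using adjoin_base[OF \<iota>, of "const_fract c" y for c]
      by (simp add: polys_over_def \<kappa>.coeff_map_poly_hom ac.coeff_map_poly_hom L_def \<iota>_const)
    show "poly (map_poly \<kappa> (map_poly to_ac g)) (\<kappa> \<theta>) = 0"
      by (simp add: \<kappa>.poly_map_poly_hom g \<kappa>.hom_zero)
  qed
  moreover have "map_poly to_ac g \<noteq> 0"
    using \<open>g \<noteq> 0\<close> by (simp add: ac.map_poly_hom_eq_0_iff)
  ultimately obtain m' where m': "m = map_poly \<kappa> m'"
    using monic_divisor_of_split_poly[OF \<kappa> _ _ m(3)] by metis
  define q where "q = map_poly of_ac m'"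
  have q: "m' = map_poly to_ac q"
  proof (rule poly_eqI)
    fix i
    have "\<kappa> (Polynomial.coeff m' i) \<in> L"
      using polys_over_coeff[OF m(1), of i] by (simp add: m' \<kappa>.coeff_map_poly_hom)
    then obtain c where "Polynomial.coeff m' i = to_ac c"
      using L_constants by blast
    thus "Polynomial.coeff m' i = Polynomial.coeff (map_poly to_ac q) i"
      by (simp add: q_def coeff_map_poly)
  qed
  have "poly (map_poly to_ac q) \<theta> = 0"
    using m(2) by (simp add: m' \<kappa>.poly_map_poly_hom \<kappa>.hom_eq_0_iff flip: q)
  moreover have "degree q < d"
    using deg_m by (simp add: m' q \<kappa>.degree_map_poly_hom ac.degree_map_poly_hom)
  ultimately have "q = 0" by (rule small)
  thus False
    using m(3) by (simp add: m' q)
qed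

section \<open>The residue ring of a polynomial over the rational function field\<close>

definition residue :: "'k::field poly poly \<Rightarrow> 'k poly fract poly \<Rightarrow> 'k poly fract poly set" where
  "residue F h = PIdl\<^bsub>kXY\<^esub> (over_kX F) +>\<^bsub>kXY\<^esub> h"

lemma type_algebra_simps [simp]:
  "carrier ring_of_type_algebra = UNIV"
  "x \<otimes>\<^bsub>ring_of_type_algebra\<^esub> y = x * y"
  "x \<oplus>\<^bsub>ring_of_type_algebra\<^esub> y = x + y"
  "\<zero>\<^bsub>ring_of_type_algebra\<^esub> = 0"
  "\<one>\<^bsub>ring_of_type_algebra\<^esub> = 1"
  by (simp_all add: ring_of_type_algebra_def)

lemma quot_map_eq_residue: "quot_map F a = residue F [:a:]"
  by (simp add: quot_map_def residue_def)

lemma PIdl_eq: "PIdl\<^bsub>kXY\<^esub> f = {g. f dvd g}"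
  by (auto simp: cgenideal_def dvd_def mult.commute)

lemma residue_eq: "residue F h = {g. over_kX F dvd g - h}"
  unfolding residue_def a_r_coset_def r_coset_def PIdl_eq
  by (auto intro!: exI[of _ "x - h" for x])

lemma residue_eq_iff: "residue F a = residue F b \<longleftrightarrow> over_kX F dvd a - b"
proof
  assume "residue F a = residue F b"
  moreover have "a \<in> residue F a" by (simp add: residue_eq)
  ultimately show "over_kX F dvd a - b" by (simp add: residue_eq)
next
  assume dvd: "over_kX F dvd a - b"
  have "over_kX F dvd g - a \<longleftrightarrow> over_kX F dvd g - b" for g
    using dvd_add_left_iff[OF dvd, of "g - a"] by simp
  thus "residue F a = residue F b" by (simp add: residue_eq)
qed

lemma kXY_cring: "cring (kXY :: 'k::field poly fract poly ring)"
  by (rule cring_from_type_algebra)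

lemma kXY_ring: "ring (kXY :: 'k::field poly fract poly ring)"
  by (rule ring_from_type_algebra)

lemma residue_ideal: "ideal (PIdl\<^bsub>kXY\<^esub> (over_kX F)) kXY"
  by (rule cring.cgenideal_ideal[OF kXY_cring]) simp

lemma residue_hom: "residue F \<in> ring_hom kXY (quot_ring F)"
  unfolding quot_ring_def residue_def[abs_def] by (rule ideal.rcos_ring_hom[OF residue_ideal])

lemma quot_ring_cring: "cring (quot_ring F)"
  unfolding quot_ring_def by (rule ideal.quotient_is_cring[OF residue_ideal kXY_cring])

lemma quot_ring_carrier: "carrier (quot_ring F) = range (residue F)"
  unfolding quot_ring_def residue_def FactRing_def A_RCOSETS_def' by auto

lemma residue_simps:
  "residue F (a + b) = residue F a \<oplus>\<^bsub>quot_ring F\<^esub> residue F b"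
  "residue F (a * b) = residue F a \<otimes>\<^bsub>quot_ring F\<^esub> residue F b"
  "\<one>\<^bsub>quot_ring F\<^esub> = residue F 1"
  "\<zero>\<^bsub>quot_ring F\<^esub> = residue F 0"
proof -
  note hom = residue_hom[of F]
  show "residue F (a + b) = residue F a \<oplus>\<^bsub>quot_ring F\<^esub> residue F b"
    using ring_hom_add[OF hom, of a b] by simp
  show "residue F (a * b) = residue F a \<otimes>\<^bsub>quot_ring F\<^esub> residue F b"
    using ring_hom_mult[OF hom, of a b] by simp
  show "\<one>\<^bsub>quot_ring F\<^esub> = residue F 1"
    using ring_hom_one[OF hom] by simp
  show "\<zero>\<^bsub>quot_ring F\<^esub> = residue F 0"
    using ring_hom_zero[OF hom kXY_ring cring.axioms(1)[OF quot_ring_cring]] by simp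
qed

lemma residue_eq_0_iff: "residue F a = \<zero>\<^bsub>quot_ring F\<^esub> \<longleftrightarrow> over_kX F dvd a"
  by (simp add: residue_simps residue_eq_iff)

lemma quot_ring_field:
  assumes "Factorial_Ring.irreducible (over_kX F)"
  shows "field (quot_ring F)"
proof -
  interpret R: cring "quot_ring F" by (rule quot_ring_cring)
  have zero_neq_one: "\<one>\<^bsub>quot_ring F\<^esub> \<noteq> \<zero>\<^bsub>quot_ring F\<^esub>"
    using assms by (simp add: residue_simps residue_eq_iff Factorial_Ring.irreducible_def)
  have "x \<in> Units (quot_ring F)" if x: "x \<in> carrier (quot_ring F)" "x \<noteq> \<zero>\<^bsub>quot_ring F\<^esub>" for x
  proof -
    obtain h where h: "x = residue F h"
      using x(1) unfolding quot_ring_carrier by (rule imageE)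
    hence "\<not> over_kX F dvd h"
      using x(2) by (simp add: residue_eq_0_iff)
    then obtain a b where ab: "a * over_kX F + b * h = 1"
      by (rule irreducible_bezout[OF assms])
    hence "b * h - 1 = over_kX F * (- a)"
      by (simp add: algebra_simps eq_diff_eq)
    hence "residue F b \<otimes>\<^bsub>quot_ring F\<^esub> x = \<one>\<^bsub>quot_ring F\<^esub>"
      unfolding h residue_simps(3) residue_simps(2)[symmetric] residue_eq_iff by simp
    thus ?thesis
      using x(1) R.m_comm[of x "residue F b"] unfolding Units_def
      by (auto simp: quot_ring_carrier)
  qed
  moreover have "\<zero>\<^bsub>quot_ring F\<^esub> \<notin> Units (quot_ring F)"
    using zero_neq_one R.Units_r_inv_ex R.l_null by metis
  ultimately show ?thesis
    by (intro R.cring_fieldI) auto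
qed

lemma dvd_pcompose_diff:
  fixes d :: "'a::idom poly"
  assumes "d dvd g - h"
  shows "d dvd pcompose q g - pcompose q h"
proof (induction q)
  case (pCons a q)
  have "pcompose (pCons a q) g - pcompose (pCons a q) h =
      (g - h) * pcompose q g + h * (pcompose q g - pcompose q h)"
    by (simp add: pcompose_pCons algebra_simps)
  thus ?case using pCons.IH assms by simp
qed simp

text \<open>
  Algebraicity is defined through polynomials written as lists with the leading coefficient first.  This lemma translates
  their evaluation into composition of polynomials.
\<close>
lemma eval_ring_hom_eq_pcompose:
  fixes \<psi> :: "'k::field poly fract poly \<Rightarrow> 'm"
  assumes "ring R" and \<psi>: "\<psi> \<in> ring_hom kXY R"
  shows "ring.eval R (map (\<lambda>a. \<psi> [:a:]) (rev (coeffs q))) (\<psi> h) = \<psi> (pcompose q h)"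
proof -
  interpret R: ring R by fact
  have closed: "\<psi> x \<in> carrier R" for x
    using ring_hom_closed[OF \<psi>, of x] by simp
  show ?thesis
  proof (induction q)
    case 0
    show ?case
      using ring_hom_zero[OF \<psi> kXY_ring assms(1)] by simp
  next
    case (pCons a q)
    have "rev (coeffs (pCons a q)) = rev (coeffs q) @ [a]"
      using pCons.hyps by (auto simp: cCons_def)
    hence "R.eval (map (\<lambda>a. \<psi> [:a:]) (rev (coeffs (pCons a q)))) (\<psi> h) =
        \<psi> (pcompose q h) \<otimes>\<^bsub>R\<^esub> \<psi> h \<oplus>\<^bsub>R\<^esub> \<psi> [:a:]"
      using R.eval_append_aux[of "map (\<lambda>a. \<psi> [:a:]) (rev (coeffs q))" "\<psi> [:a:]" "\<psi> h"]
        closed pCons.IH by (simp add: image_subset_iff)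
    also have "\<dots> = \<psi> (pcompose q h * h + [:a:])"
      using ring_hom_add[OF \<psi>, of "pcompose q h * h" "[:a:]"] ring_hom_mult[OF \<psi>, of "pcompose q h" h]
      by simp
    finally show ?case
      by (simp add: pcompose_pCons algebra_simps)
  qed
qed

text \<open>
  Both sides are homomorphisms in \<open>q\<close>, and a homomorphism on \<open>k(X)[Y]\<close> is determined by its values
  on constants and at \<open>Y\<close>.
\<close>
lemma ring_homs_eq_pcompose:
  assumes \<psi>: "\<psi> \<in> ring_hom kXY R" "ring R" and F: "residue F \<in> ring_hom kXY R"
    and const: "\<And>a. \<psi> [:a:] = residue F [:a:]" and gen: "\<psi> [:0, 1:] = residue F h"
  shows "\<psi> q = residue F (pcompose q h)"
proof (induction q)
  case 0
  show ?case using const[of 0] by simp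
next
  case (pCons a q)
  have "\<psi> (pCons a q) = \<psi> ([:a:] + [:0, 1:] * q)"
    by simp
  also have "\<dots> = \<psi> [:a:] \<oplus>\<^bsub>R\<^esub> \<psi> [:0, 1:] \<otimes>\<^bsub>R\<^esub> \<psi> q"
    using ring_hom_add[OF \<psi>(1), of "[:a:]" "[:0, 1:] * q"] ring_hom_mult[OF \<psi>(1), of "[:0, 1:]" q]
    by simp
  also have "\<dots> = residue F ([:a:] + h * pcompose q h)"
    using ring_hom_add[OF F, of "[:a:]" "h * pcompose q h"] ring_hom_mult[OF F, of h "pcompose q h"]
    by (simp add: const gen pCons.IH)
  finally show ?case by (simp add: pcompose_pCons)
qed

context
  fixes F :: "'k::field poly poly"
  assumes irr: "Factorial_Ring.irreducible (over_kX F)"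
begin

interpretation R: field "quot_ring F"
  by (rule quot_ring_field[OF irr])

lemma dvd_const_imp_0:
  assumes "over_kX F dvd [:a:]"
  shows "a = 0"
proof (rule ccontr)
  assume "a \<noteq> 0"
  hence "[:a:] dvd 1"
    by (simp add: is_unit_const_poly_iff dvd_field_iff)
  with assms have "over_kX F dvd 1" by (rule dvd_trans)
  with irr show False by (simp add: Factorial_Ring.irreducible_def)
qed

context
  fixes e :: "'c::field \<Rightarrow> 'k poly fract"
  assumes e: "ring_embedding e"
begin

interpretation ring_embedding e by (fact e)

lemma coefficient_field_hom: "(\<lambda>c. quot_map F (e c)) \<in> ring_hom ring_of_type_algebra (quot_ring F)"
  by (intro ring_hom_memI)
     (simp_all add: quot_map_eq_residue quot_ring_carrier hom_add hom_mult hom_one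
        residue_simps(3) one_pCons mult.commute flip: residue_simps(1,2))

lemma coefficient_subfield: "subfield (range (\<lambda>c. quot_map F (e c))) (quot_ring F)"
proof -
  interpret C: field "ring_of_type_algebra :: 'c ring"
    by (rule field_from_type_algebra)
  interpret h: ring_hom_ring "ring_of_type_algebra :: 'c ring" "quot_ring F" "\<lambda>c. quot_map F (e c)"
    by (intro ring_hom_ringI2 coefficient_field_hom C.ring_axioms R.ring_axioms)
  show ?thesis
    using h.img_is_subfield(2)[OF C.carrier_is_subfield R.one_not_zero] by simp
qed

text \<open>
  The embedding \<open>e\<close> is a parameter because the lemma is applied to two coefficient fields: to \<open>k\<close>, for the
  algebraic elements of the theorem, and to \<open>k(X)\<close>, for finiteness of the extension.
\<close>
lemma algebraic_iff_pcompose: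
  "(R.algebraic over range (\<lambda>c. quot_map F (e c))) (residue F h) \<longleftrightarrow>
     (\<exists>p. p \<noteq> 0 \<and> over_kX F dvd pcompose (map_poly e p) h)"
  (is "(R.algebraic over ?K) _ \<longleftrightarrow> _")
proof -
  have coeffs: "rev (coeffs (map_poly e p)) = map e (rev (coeffs p))" for p
    by (simp add: coeffs_map_poly' hom_eq_0_iff rev_map)
  have eval: "R.eval (map (\<lambda>c. quot_map F (e c)) (rev (coeffs p))) (residue F h) =
      residue F (pcompose (map_poly e p) h)" for p
    using eval_ring_hom_eq_pcompose[OF R.ring_axioms residue_hom, of "map_poly e p" h]
    unfolding coeffs by (simp add: quot_map_eq_residue o_def)
  have nz: "quot_map F (e c) = \<zero>\<^bsub>quot_ring F\<^esub> \<longleftrightarrow> c = 0" for c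
    using dvd_const_imp_0[of "e c"] by (auto simp: quot_map_eq_residue residue_eq_0_iff hom_eq_0_iff hom_zero)
  show ?thesis
  proof
    assume "(R.algebraic over ?K) (residue F h)"
    then obtain xs where xs: "xs \<in> carrier (univ_poly (quot_ring F) ?K)" "xs \<noteq> []"
      "R.eval xs (residue F h) = \<zero>\<^bsub>quot_ring F\<^esub>"
      using R.algebraicE[OF subfieldE(1)[OF coefficient_subfield]]
      by (metis quot_ring_carrier rangeI)
    hence set: "set xs \<subseteq> ?K" and hd: "hd xs \<noteq> \<zero>\<^bsub>quot_ring F\<^esub>"
      by (auto simp: univ_poly_def polynomial_def)
    from set have "xs \<in> lists ?K" by auto
    hence "xs \<in> map (\<lambda>c. quot_map F (e c)) ` lists UNIV"
      by (simp only: lists_image)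
    then obtain cs where cs: "xs = map (\<lambda>c. quot_map F (e c)) cs"
      by blast
    define p where "p = Poly (rev cs)"
    \<comment> \<open>The list \<open>xs\<close> has nonzero leading coefficient, so no leading zeros are lost in the translation.\<close>
    have "cs \<noteq> []" "hd cs \<noteq> 0"
      using xs(2) hd cs nz by (auto simp: hd_map)
    hence p: "coeffs p = rev cs"
      unfolding p_def coeffs_Poly by (subst strip_while_idem_iff[THEN iffD2]) (cases cs; simp)+
    hence "p \<noteq> 0" using \<open>cs \<noteq> []\<close> by auto
    moreover have "over_kX F dvd pcompose (map_poly e p) h"
    proof -
      have "residue F (pcompose (map_poly e p) h) = \<zero>\<^bsub>quot_ring F\<^esub>"
        using xs(3) eval[of p] p cs by simp
      thus ?thesis by (simp only: residue_eq_0_iff)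
    qed
    ultimately show "\<exists>p. p \<noteq> 0 \<and> over_kX F dvd pcompose (map_poly e p) h" by blast
  next
    assume "\<exists>p. p \<noteq> 0 \<and> over_kX F dvd pcompose (map_poly e p) h"
    then obtain p where p: "p \<noteq> 0" "over_kX F dvd pcompose (map_poly e p) h" by blast
    define xs where "xs = map (\<lambda>c. quot_map F (e c)) (rev (coeffs p))"
    have "coeffs p \<noteq> []" using p(1) by simp
    have "xs \<in> carrier (univ_poly (quot_ring F) ?K)"
      using p(1) \<open>coeffs p \<noteq> []\<close> by (auto simp: univ_poly_def polynomial_def xs_def hd_map hd_rev nz
          last_coeffs_eq_coeff_degree)
    moreover have "xs \<noteq> []" using p(1) by (simp add: xs_def)
    moreover have "R.eval xs (residue F h) = \<zero>\<^bsub>quot_ring F\<^esub>"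
      unfolding xs_def eval using p(2) by (simp add: residue_eq_0_iff)
    ultimately show "(R.algebraic over ?K) (residue F h)"
      unfolding over_def by (rule R.algebraicI[unfolded over_def])
  qed
qed

end

lemma constants_eq: "constants F = range (\<lambda>c. quot_map F (const_fract c))"
  by (simp add: constants_def const_fract_def)

lemma algebraic_elements_eq_constants_iff:
  "algebraic_elements F = constants F \<longleftrightarrow> regular_poly F"
proof
  assume eq: "algebraic_elements F = constants F"
  show "regular_poly F"
    unfolding regular_poly_def
  proof (intro allI impI)
    fix p :: "'k poly" and h assume "p \<noteq> 0 \<and> over_kX F dvd pcompose (map_poly const_fract p) h"
    hence "residue F h \<in> algebraic_elements F"
      using algebraic_iff_pcompose[OF const_fract_embedding, of h]
      by (auto simp: algebraic_elements_def quot_ring_carrier constants_eq)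
    thus "\<exists>c. over_kX F dvd h - [:const_fract c:]"
      unfolding eq constants_eq by (auto simp: quot_map_eq_residue residue_eq_iff)
  qed
next
  assume reg: "regular_poly F"
  have "residue F h \<in> constants F"
    if "(R.algebraic over constants F) (residue F h)" for h
    using that reg unfolding regular_poly_def constants_eq algebraic_iff_pcompose[OF const_fract_embedding]
    by (auto simp: image_iff quot_map_eq_residue residue_eq_iff)
  moreover have "(R.algebraic over constants F) x" if "x \<in> constants F" for x
    using that R.algebraic_self[OF subfieldE(1)[OF coefficient_subfield[OF const_fract_embedding]]]
    unfolding constants_eq by blast
  moreover have "constants F \<subseteq> carrier (quot_ring F)"
    by (auto simp: constants_eq quot_map_eq_residue quot_ring_carrier)
  ultimately show "algebraic_elements F = constants F"
    by (auto simp: algebraic_elements_def quot_ring_carrier)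
qed

end

section \<open>Genuine extensions\<close>

text \<open>
  The zero polynomial is included on both sides.
\<close>
lemma degree_X_eq_0_iff:
  "degree_X G = 0 \<longleftrightarrow> (\<exists>g. G = map_poly (\<lambda>c. [:c:]) g)"
proof -
  let ?S = "{m. \<exists>l. bicoeff G l m \<noteq> 0}"
  have "?S \<subseteq> (\<Union>l\<le>degree G. {..degree (Polynomial.coeff G l)})"
    by (auto simp: bicoeff_def) (metis atMost_iff coeff_0 le_degree)
  hence "finite ?S"
    by (rule finite_subset) auto
  hence "degree_X G = 0 \<longleftrightarrow> (\<forall>m. (\<exists>l. bicoeff G l m \<noteq> 0) \<longrightarrow> m = 0)"
    unfolding degree_X_def by (subst Max_eq_iff) auto
  also have "\<dots> \<longleftrightarrow> (\<exists>g. G = map_poly (\<lambda>c. [:c:]) g)"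
  proof
    assume *: "\<forall>m. (\<exists>l. bicoeff G l m \<noteq> 0) \<longrightarrow> m = 0"
    have "G = map_poly (\<lambda>c. [:c:]) (map_poly (\<lambda>p. Polynomial.coeff p 0) G)"
    proof (rule poly_eqI, rule poly_eqI)
      fix l m
      show "Polynomial.coeff (Polynomial.coeff G l) m =
          Polynomial.coeff (Polynomial.coeff (map_poly (\<lambda>c. [:c:]) (map_poly (\<lambda>p. Polynomial.coeff p 0) G)) l) m"
        using * by (cases m) (auto simp: coeff_map_poly bicoeff_def)
    qed
    thus "\<exists>g. G = map_poly (\<lambda>c. [:c:]) g" ..
  next
    assume "\<exists>g. G = map_poly (\<lambda>c. [:c:]) g"
    then obtain g where "G = map_poly (\<lambda>c. [:c:]) g" ..
    hence "bicoeff G l (Suc m) = 0" for l m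
      by (simp add: bicoeff_def coeff_map_poly)
    thus "\<forall>m. (\<exists>l. bicoeff G l m \<noteq> 0) \<longrightarrow> m = 0"
      by (metis not0_implies_Suc)
  qed
  finally show ?thesis .
qed

lemma over_kX_map_const: "over_kX (map_poly (\<lambda>c. [:c:]) g) = map_poly const_fract g"
  unfolding over_kX_def const_fract_def
  by (rule map_poly_embedding_compose[OF const_poly_embedding to_fract_embedding])

text \<open>
  Over the closure the divisor is a product of linear factors with constant roots, so its coefficients
  are constants that come from \<open>k(X)\<close>.
\<close>
lemma monic_divisor_has_constant_coeffs:
  fixes p :: "'k::field poly"
  assumes "p \<noteq> 0" "m dvd map_poly const_fract p" "lead_coeff m = 1"
  obtains g where "m = map_poly const_fract g"
proof -
  interpret ext: ring_embedding "extend_constants :: 'k poly fract \<Rightarrow> _"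
    by (rule extend_constants_embedding)
  interpret c: ring_embedding "const_fract :: 'k \<Rightarrow> _"
    by (rule const_fract_embedding)
  interpret c': ring_embedding "const_fract :: 'k alg_closure \<Rightarrow> _"
    by (rule const_fract_embedding)
  have "map_poly extend_constants m dvd map_poly const_fract (map_poly to_ac p)"
    using ext.map_poly_hom_dvd[OF assms(2)] by (simp add: extend_constants_map_const_fract)
  moreover have "map_poly to_ac p \<noteq> 0"
    using assms(1) by (simp add: ring_embedding.map_poly_hom_eq_0_iff[OF to_ac_embedding])
  moreover have "lead_coeff (map_poly extend_constants m) = 1"
    unfolding ext.lead_coeff_map_poly_hom assms(3) by (rule ext.hom_one)
  ultimately obtain m' where m': "map_poly extend_constants m = map_poly const_fract m'"
    using monic_divisor_of_split_poly[OF const_fract_embedding] by metis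
  have "\<exists>c. Polynomial.coeff m i = const_fract c" for i
  proof -
    have "extend_constants (Polynomial.coeff m i) = const_fract (Polynomial.coeff m' i)"
      using arg_cong[OF m', of "\<lambda>p. Polynomial.coeff p i"]
      by (simp add: ext.coeff_map_poly_hom c'.coeff_map_poly_hom)
    thus ?thesis
      using constant_descends by metis
  qed
  hence mem: "Polynomial.coeff m i \<in> range const_fract" for i
    by auto
  have "m = map_poly const_fract (map_poly (inv_into UNIV const_fract) m)"
  proof (rule poly_eqI)
    fix i
    have inv: "inv_into UNIV const_fract (const_fract c) = c" for c :: 'k
      by (rule inv_f_f) (auto intro!: injI simp: c.hom_eq_iff)
    have "inv_into UNIV const_fract 0 = (0 :: 'k)"
      using inv[of 0] by (simp add: c.hom_zero)
    thus "Polynomial.coeff m i = Polynomial.coeff (map_poly const_fract (map_poly (inv_into UNIV const_fract) m)) i"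
      using mem[of i] by (simp add: c.coeff_map_poly_hom coeff_map_poly f_inv_into_f)
  qed
  thus ?thesis by (rule that)
qed

text \<open>
  The field \<open>k\<close> is algebraically closed in \<open>k(X)\<close>: apply the previous lemma to the divisor \<open>T - a\<close>.
\<close>
lemma root_of_constant_poly_is_constant:
  fixes p :: "'k::field poly"
  assumes "p \<noteq> 0" "poly (map_poly const_fract p) a = 0"
  obtains c where "a = const_fract c"
proof -
  have "[:- a, 1:] dvd map_poly const_fract p"
    using assms(2) by (simp add: poly_eq_0_iff_dvd)
  then obtain g where "[:- a, 1:] = map_poly const_fract g"
    using monic_divisor_has_constant_coeffs[OF assms(1), of "[:- a, 1:]"] by auto
  hence "Polynomial.coeff [:- a, 1:] 0 = Polynomial.coeff (map_poly const_fract g) 0"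
    by simp
  hence "- a = const_fract (Polynomial.coeff g 0)"
    by (simp add: ring_embedding.coeff_map_poly_hom[OF const_fract_embedding])
  hence "a = const_fract (- Polynomial.coeff g 0)"
    unfolding ring_embedding.hom_uminus[OF const_fract_embedding] by (metis minus_minus)
  thus ?thesis by (rule that)
qed

context
  fixes F :: "'k::field poly poly"
  assumes irr: "Factorial_Ring.irreducible (over_kX F)"
begin

interpretation R: field "quot_ring F"
  by (rule quot_ring_field[OF irr])

lemma quot_map_hom: "quot_map F \<in> ring_hom ring_of_type_algebra (quot_ring F)"
  using coefficient_field_hom[OF irr, of "\<lambda>x. x"] by (simp add: ring_embedding_def)

lemma quot_map_subfield: "subfield (range (quot_map F)) (quot_ring F)"
  using coefficient_subfield[OF irr, of "\<lambda>x. x"] by (simp add: ring_embedding_def)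

lemma algebraic_over_base_iff:
  "(R.algebraic over range (quot_map F)) (residue F h) \<longleftrightarrow>
     (\<exists>q. q \<noteq> 0 \<and> over_kX F dvd pcompose q h)"
  using algebraic_iff_pcompose[OF irr, of "\<lambda>x. x" h] by (simp add: ring_embedding_def)

text \<open>
  The class of \<open>Y\<close> generates the field and is a root of \<open>F\<close>.
\<close>
lemma quot_ring_finite_dimension: "R.finite_dimension (range (quot_map F)) (carrier (quot_ring F))"
proof -
  define x where "x = residue F [:0, 1:]"
  let ?K = "range (quot_map F)"
  have x: "x \<in> carrier (quot_ring F)"
    by (simp add: x_def quot_ring_carrier)
  have K: "?K \<subseteq> carrier (quot_ring F)"
    by (auto simp: quot_map_eq_residue quot_ring_carrier)
  have "residue F q \<in> R.simple_extension ?K x" for q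
  proof (induction q)
    case 0
    show ?case
      using R.simple_extension.zero[of ?K x] by (simp add: residue_simps)
  next
    case (pCons a q)
    have "residue F (pCons a q) = residue F (q * [:0, 1:] + [:a:])"
      by (simp add: mult.commute)
    also have "\<dots> = residue F q \<otimes>\<^bsub>quot_ring F\<^esub> x \<oplus>\<^bsub>quot_ring F\<^esub> quot_map F a"
      unfolding residue_simps(1,2) by (simp only: x_def quot_map_eq_residue)
    also have "\<dots> \<in> R.simple_extension ?K x"
      by (rule R.simple_extension.lin[OF pCons.IH]) simp
    finally show ?case .
  qed
  hence "R.simple_extension ?K x = carrier (quot_ring F)"
    using R.simple_extension_in_carrier[OF K x] by (auto simp: quot_ring_carrier)
  moreover have "(R.algebraic over ?K) x"
    unfolding x_def algebraic_over_base_iff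
    using irr by (intro exI[of _ "over_kX F"]) (auto simp: pcompose_idR)
  ultimately show ?thesis
    using R.finite_dimension_simple_extension[OF quot_map_subfield x] by simp
qed

text \<open>
  A spanning list inside the large field already consists of elements of \<open>M\<close>, so it also serves when
  dimension is computed in \<open>M\<close> as a ring of its own.
\<close>
lemma intermediate_field_finite_dimension:
  assumes M: "subfield M (quot_ring F)" "range (quot_map F) \<subseteq> M"
  shows "ring.finite_dimension (quot_ring F\<lparr>carrier := M\<rparr>) (range (quot_map F)) M"
proof -
  let ?K = "range (quot_map F)"
  interpret M: field "quot_ring F\<lparr>carrier := M\<rparr>"
    by (rule R.subfield_iff(2)[OF M(1)])
  have sub: "subring M (quot_ring F)"
    by (rule subfieldE(1)[OF M(1)])
  have "subalgebra ?K M (quot_ring F)"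
    using subring.axioms(1)[OF sub] subringE(6)[OF sub] M(2)
    by (intro subalgebra.intro subalgebra_axioms.intro) auto
  hence "R.finite_dimension ?K M"
    using R.subalbegra_incl_imp_finite_dimension[OF quot_map_subfield quot_ring_finite_dimension]
      subringE(1)[OF sub] by blast
  then obtain Us where Us: "set Us \<subseteq> carrier (quot_ring F)" "R.independent ?K Us" "R.Span ?K Us = M"
    using R.exists_base[OF quot_map_subfield] by (metis R.finite_dimensionE')
  have "set Us \<subseteq> M"
    using R.Span_base_incl[OF quot_map_subfield Us(1)] Us(3) by simp
  moreover have "subfield ?K (quot_ring F\<lparr>carrier := M\<rparr>)"
    using R.subfield_iff(2)[OF quot_map_subfield] M(2) by (intro M.subfield_iff(1)) simp_all
  ultimately have "M.finite_dimension ?K (M.Span ?K Us)"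
    by (intro M.Span_finite_dimension) simp_all
  thus ?thesis
    using Us(3) R.Span_consistent[OF sub] by simp
qed

lemma intermediate_field_extension:
  assumes M: "subfield M (quot_ring F)" "range (quot_map F) \<subset> M"
  shows "finite_nontrivial_extension (quot_map F) (quot_ring F\<lparr>carrier := M\<rparr>)"
  unfolding finite_nontrivial_extension_def
proof (intro conjI)
  show "field (quot_ring F\<lparr>carrier := M\<rparr>)"
    by (rule R.subfield_iff(2)[OF M(1)])
  show "quot_map F \<in> ring_hom ring_of_type_algebra (quot_ring F\<lparr>carrier := M\<rparr>)"
    using quot_map_hom M(2) by (auto simp: ring_hom_def)
  show "ring.finite_dimension (quot_ring F\<lparr>carrier := M\<rparr>) (range (quot_map F))
      (carrier (quot_ring F\<lparr>carrier := M\<rparr>))"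
    using intermediate_field_finite_dimension[OF M(1)] M(2) by auto
  show "range (quot_map F) \<noteq> carrier (quot_ring F\<lparr>carrier := M\<rparr>)"
    using M(2) by auto
qed

text \<open>
  Let \<open>h\<close> represent the image in \<open>M\<close> of the class of \<open>Y\<close> modulo \<open>G\<close>.  The presentation is then the map
  \<open>q \<mapsto> q(h)\<close>, and \<open>G(h) = 0\<close> makes \<open>h\<close> algebraic over \<open>k\<close>, so that \<open>h\<close> is a constant modulo \<open>F\<close> and
  all values \<open>q(h)\<close> are in \<open>k(X)\<close>.
\<close>
lemma presented_intermediate_field_trivial:
  assumes reg: "regular_poly F" and M: "subfield M (quot_ring F)" "range (quot_map F) \<subseteq> M"
    and pres: "presented_by (quot_map F) (quot_ring F\<lparr>carrier := M\<rparr>) G" and G: "degree_X G = 0"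
  shows "M = range (quot_map F)"
proof -
  obtain \<phi> where \<phi>: "\<phi> \<in> ring_iso (quot_ring G) (quot_ring F\<lparr>carrier := M\<rparr>)"
    "\<And>a. \<phi> (quot_map G a) = quot_map F a"
    using pres by (auto simp: presented_by_def)
  have M_carrier: "M \<subseteq> carrier (quot_ring F)"
    by (rule subringE(1)[OF subfieldE(1)[OF M(1)]])
  have bij: "bij_betw \<phi> (range (residue G)) M"
    using ring_iso_memE(5)[OF \<phi>(1)] by (simp add: quot_ring_carrier)
  have "\<phi> (residue G [:0, 1:]) \<in> M"
    using bij by (auto simp: bij_betw_def)
  then obtain h where h: "\<phi> (residue G [:0, 1:]) = residue F h"
    using M_carrier unfolding quot_ring_carrier by blast
  have "\<phi> \<in> ring_hom (quot_ring G) (quot_ring F)"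
    using \<phi>(1) M_carrier by (auto simp: ring_iso_def ring_hom_def)
  hence hom: "(\<lambda>q. \<phi> (residue G q)) \<in> ring_hom kXY (quot_ring F)"
    using ring_hom_trans[OF residue_hom[of G]] by (simp add: o_def)
  have \<phi>_residue: "\<phi> (residue G q) = residue F (pcompose q h)" for q
    by (rule ring_homs_eq_pcompose[OF hom R.ring_axioms residue_hom _ h])
       (use \<phi>(2) in \<open>simp add: quot_map_eq_residue\<close>)
  have inj: "over_kX G dvd q" if "over_kX F dvd pcompose q h" for q
  proof -
    have "\<phi> (residue G q) = \<phi> (residue G 0)"
      using that by (simp add: \<phi>_residue residue_eq_iff)
    hence "residue G q = residue G 0"
      using bij by (auto simp: bij_betw_def dest: inj_onD)
    thus ?thesis by (simp add: residue_eq_iff)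
  qed
  \<comment> \<open>Algebraicity of \<open>h\<close> over \<open>k(X)\<close> excludes \<open>G = 0\<close>, which also has degree \<open>0\<close> in \<open>X\<close>.\<close>
  obtain q where q: "q \<noteq> 0" "over_kX F dvd pcompose q h"
    using R.finite_dimension_imp_algebraic[OF quot_map_subfield R.carrier_is_subring
        quot_ring_finite_dimension, of "residue F h"] algebraic_over_base_iff
    by (auto simp: quot_ring_carrier)
  obtain g where g: "G = map_poly (\<lambda>c. [:c:]) g"
    using G degree_X_eq_0_iff by auto
  have "g \<noteq> 0"
    using inj[OF q(2)] q(1) by (auto simp: g over_kX_def)
  moreover have "over_kX F dvd pcompose (map_poly const_fract g) h"
  proof -
    have "residue G (over_kX G) = residue G 0"
      by (simp add: residue_eq_iff)
    hence "residue F (pcompose (over_kX G) h) = residue F (pcompose 0 h)"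
      unfolding \<phi>_residue[symmetric] by simp
    thus ?thesis
      by (simp add: residue_eq_iff g over_kX_map_const)
  qed
  ultimately obtain c where c: "over_kX F dvd h - [:const_fract c:]"
    using reg unfolding regular_poly_def by blast
  have "residue F (pcompose q h) = quot_map F (poly q (const_fract c))" for q
    using dvd_pcompose_diff[OF c, of q] by (simp add: quot_map_eq_residue residue_eq_iff pcompose_pCons_0)
  hence "\<phi> ` range (residue G) \<subseteq> range (quot_map F)"
    by (auto simp: \<phi>_residue)
  thus ?thesis
    using bij M(2) by (auto simp: bij_betw_def)
qed

lemma strongly_one_genuine_if_regular_poly:
  assumes "regular_poly F" "degree F \<ge> 2"
  shows "strongly_one_genuine_extension (quot_map F) (quot_ring F)"
  unfolding strongly_one_genuine_extension_def one_genuine_extension_def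
proof (intro conjI allI impI; (elim conjE)?)
  have "range (quot_map F) \<noteq> carrier (quot_ring F)"
  proof
    assume "range (quot_map F) = carrier (quot_ring F)"
    hence "residue F [:0, 1:] \<in> range (quot_map F)"
      by (simp add: quot_ring_carrier)
    then obtain a where "residue F [:0, 1:] = quot_map F a" by blast
    hence "over_kX F dvd [:- a, 1:]"
      by (simp add: quot_map_eq_residue residue_eq_iff)
    from dvd_imp_degree_le[OF this] show False
      using assms(2) by (simp add: degree_over_kX)
  qed
  thus "finite_nontrivial_extension (quot_map F) (quot_ring F)"
    using R.field_axioms quot_map_hom quot_ring_finite_dimension
    by (simp add: finite_nontrivial_extension_def)
next
  fix M assume "subfield M (quot_ring F)" "range (quot_map F) \<subset> M"
  thus "finite_nontrivial_extension (quot_map F) (quot_ring F\<lparr>carrier := M\<rparr>)"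
    by (rule intermediate_field_extension)
next
  fix M G
  assume "subfield M (quot_ring F)" "range (quot_map F) \<subset> M"
    and "presented_by (quot_map F) (quot_ring F\<lparr>carrier := M\<rparr>) G"
  thus "degree_X G \<noteq> 0"
    using presented_intermediate_field_trivial[OF assms(1), of M G] by auto
qed

text \<open>
  If regularity fails at \<open>h\<close>, then the minimal polynomial \<open>m\<close> of the class of \<open>h\<close> over \<open>k(X)\<close> has
  coefficients in \<open>k\<close>.  So \<open>m\<close> presents the field generated by that class, and this presentation has
  degree \<open>0\<close> in \<open>X\<close>.
\<close>
lemma regular_poly_if_strongly_one_genuine:
  assumes gen: "strongly_one_genuine_extension (quot_map F) (quot_ring F)"
  shows "regular_poly F"
  unfolding regular_poly_def
proof (intro allI impI, rule ccontr)
  fix p h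
  assume p: "p \<noteq> 0 \<and> over_kX F dvd pcompose (map_poly const_fract p) h"
    and nc: "\<nexists>c. over_kX F dvd h - [:const_fract c:]"
  note prime = field_poly_irreducible_imp_prime[OF irr]
  define I where "I = {q. over_kX F dvd pcompose q h}"
  have mem: "map_poly const_fract p \<in> I" "map_poly const_fract p \<noteq> 0"
    using p by (simp_all add: I_def ring_embedding.map_poly_hom_eq_0_iff[OF const_fract_embedding])
  obtain m where m: "m \<in> I" "lead_coeff m = 1" and m_min: "\<And>q. q \<in> I \<Longrightarrow> m dvd q"
    by (rule principal_generator[OF is_subfield_UNIV, of I "map_poly const_fract p"])
       (use mem in \<open>auto simp: I_def pcompose_diff pcompose_mult\<close>)
  obtain g where g: "m = map_poly const_fract g"
    using monic_divisor_has_constant_coeffs[OF _ m_min[OF mem(1)] m(2)] p by metis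
  define G where "G = map_poly (\<lambda>c. [:c:]) g"
  have G: "over_kX G = m" "degree_X G = 0"
    using degree_X_eq_0_iff by (auto simp: G_def over_kX_map_const g)
  have I_iff: "q \<in> I \<longleftrightarrow> m dvd q" for q
  proof
    assume "m dvd q"
    then obtain r where "q = m * r" by (rule dvdE)
    thus "q \<in> I" using m(1) by (simp add: I_def pcompose_mult)
  qed (rule m_min)
  have "prime_elem m"
  proof (rule prime_elemI)
    show "m \<noteq> 0" using m(2) by auto
    show "\<not> m dvd 1"
      using prime_elem_not_unit[OF prime] unfolding I_iff[symmetric] by (simp add: I_def pcompose_1)
    show "m dvd a \<or> m dvd b" if "m dvd a * b" for a b
      using that prime_elem_dvd_multD[OF prime] unfolding I_iff[symmetric]
      by (simp add: I_def pcompose_mult)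
  qed
  hence "Factorial_Ring.irreducible (over_kX G)"
    unfolding G by (rule prime_elem_imp_irreducible)
  hence field_G: "field (quot_ring G)"
    by (rule quot_ring_field)

  define \<psi> where "\<psi> = (\<lambda>q. residue F (pcompose q h))"
  define M where "M = range \<psi>"
  interpret \<psi>: ring_hom_ring "kXY :: 'k poly fract poly ring" "quot_ring F" \<psi>
  proof (intro ring_hom_ringI2 kXY_ring R.ring_axioms ring_hom_memI)
    show "\<psi> \<one>\<^bsub>kXY\<^esub> = \<one>\<^bsub>quot_ring F\<^esub>"
      by (simp add: \<psi>_def residue_simps(3) pcompose_1)
  qed (simp_all add: \<psi>_def quot_ring_carrier pcompose_add pcompose_mult residue_simps(1,2))
  \<comment> \<open>The first isomorphism theorem for \<open>q \<mapsto> q(h)\<close> yields the presentation.\<close>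
  have kernel: "a_kernel kXY (quot_ring F) \<psi> = PIdl\<^bsub>kXY\<^esub> (over_kX G)"
    using I_iff by (auto simp: a_kernel_def' PIdl_eq G \<psi>_def residue_eq_0_iff I_def)
  define \<phi> where "\<phi> = (\<lambda>Z. the_elem (\<psi> ` Z))"
  have \<phi>: "\<phi> \<in> ring_iso (quot_ring G) (quot_ring F\<lparr>carrier := M\<rparr>)"
    using \<psi>.FactRing_iso_set_aux unfolding kernel by (simp add: quot_ring_def M_def \<phi>_def)
  have "\<phi> (quot_map G a) = quot_map F a" for a
    using \<psi>.the_elem_simp[of "[:a:]"] unfolding kernel
    by (simp add: \<phi>_def quot_map_def) (simp add: \<psi>_def residue_def)
  hence pres: "presented_by (quot_map F) (quot_ring F\<lparr>carrier := M\<rparr>) G"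
    using \<phi> by (auto simp: presented_by_def)

  have "field (quot_ring F\<lparr>carrier := M\<rparr>)"
  proof -
    interpret G: field "quot_ring G" by (rule field_G)
    have "ring (quot_ring F\<lparr>carrier := M\<rparr>)"
      using \<psi>.img_is_ring by (simp add: M_def)
    moreover have "\<phi> \<in> ring_hom (quot_ring G) (quot_ring F\<lparr>carrier := M\<rparr>)"
      using \<phi> by (simp add: ring_iso_def)
    ultimately have "\<phi> \<zero>\<^bsub>quot_ring G\<^esub> = \<zero>\<^bsub>quot_ring F\<lparr>carrier := M\<rparr>\<^esub>"
      using ring_hom_zero G.ring_axioms by blast
    thus ?thesis
      using G.ring_iso_imp_img_field[OF \<phi>] by simp
  qed
  hence "subfield M (quot_ring F)"
    by (rule R.subfield_iff(1)) (auto simp: M_def \<psi>_def quot_ring_carrier)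
  moreover have "range (quot_map F) \<subset> M"
  proof
    show "range (quot_map F) \<subseteq> M"
    proof
      fix x assume "x \<in> range (quot_map F)"
      then obtain a where "x = quot_map F a" by blast
      hence "x = \<psi> [:a:]" by (simp add: \<psi>_def quot_map_eq_residue)
      thus "x \<in> M" by (simp add: M_def)
    qed
    show "range (quot_map F) \<noteq> M"
    proof
      assume eq: "range (quot_map F) = M"
      have "residue F h = \<psi> [:0, 1:]"
        by (simp add: \<psi>_def pcompose_pCons)
      hence "residue F h \<in> range (quot_map F)"
        by (simp add: eq M_def)
      then obtain a where "residue F h = quot_map F a" by blast
      hence a: "over_kX F dvd h - [:a:]"
        by (simp add: quot_map_eq_residue residue_eq_iff)
      have "over_kX F dvd pcompose (map_poly const_fract p) [:a:]"
        using dvd_pcompose_diff[OF a, of "map_poly const_fract p"] p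
        by (metis dvd_diff_commute dvd_diff_right_iff)
      hence "poly (map_poly const_fract p) a = 0"
        by (intro dvd_const_imp_0[OF irr]) (simp add: pcompose_pCons_0)
      then obtain c where "a = const_fract c"
        using root_of_constant_poly_is_constant p by metis
      with a nc show False by blast
    qed
  qed
  ultimately have "degree_X G \<noteq> 0"
    using gen pres unfolding strongly_one_genuine_extension_def one_genuine_extension_def by blast
  with G(2) show False by simp
qed

end

section \<open>Total degree and factorisation over the closure\<close>

lemma finite_bicoeff_support: "finite {(l, m). bicoeff f l m \<noteq> 0}"
proof (rule finite_subset)
  show "{(l, m). bicoeff f l m \<noteq> 0} \<subseteq> (SIGMA l:{..degree f}. {..degree (Polynomial.coeff f l)})"
    by (auto simp: bicoeff_def) (metis coeff_0 le_degree, metis le_degree)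
qed auto

lemma finite_total_degrees: "finite {l + m | l m. bicoeff f l m \<noteq> 0}"
proof -
  have "{l + m | l m. bicoeff f l m \<noteq> 0} = (\<lambda>(l, m). l + m) ` {(l, m). bicoeff f l m \<noteq> 0}"
    by auto
  thus ?thesis by (simp only: finite_imageI[OF finite_bicoeff_support])
qed

lemma le_total_degree: "bicoeff f l m \<noteq> 0 \<Longrightarrow> l + m \<le> total_degree f"
  unfolding total_degree_def using finite_total_degrees by (intro Max_ge) auto

lemma bicoeff_eqI: "(\<And>l m. bicoeff f l m = bicoeff g l m) \<Longrightarrow> f = g"
  by (intro poly_eqI) (simp add: bicoeff_def)

lemma total_degree_attained:
  assumes "f \<noteq> 0"
  obtains l m where "bicoeff f l m \<noteq> 0" "l + m = total_degree f"
proof -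
  obtain l0 m0 where "bicoeff f l0 m0 \<noteq> 0"
    using assms bicoeff_eqI[of f 0] by (auto simp: bicoeff_def)
  hence nonempty: "{l + m | l m. bicoeff f l m \<noteq> 0} \<noteq> {}" by auto
  hence "total_degree f = Max {l + m | l m. bicoeff f l m \<noteq> 0}"
    unfolding total_degree_def using finite_total_degrees by (subst Max_insert) auto
  hence "total_degree f \<in> {l + m | l m. bicoeff f l m \<noteq> 0}"
    using Max_in[OF finite_total_degrees nonempty] by (simp only:)
  thus ?thesis using that by auto
qed

lemma bicoeff_mult:
  fixes f g :: "'a::comm_semiring_0 poly poly"
  shows "bicoeff (f * g) l m = (\<Sum>i\<le>l. \<Sum>j\<le>m. bicoeff f i j * bicoeff g (l - i) (m - j))"
  by (simp add: bicoeff_def coeff_mult coeff_sum)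

text \<open>
  Among the terms of top total degree in each factor, take the one with the largest exponent of \<open>Y\<close>.
  The product of these two terms cannot cancel.
\<close>
lemma total_degree_mult:
  fixes f g :: "'a::idom poly poly"
  assumes "f \<noteq> 0" "g \<noteq> 0"
  shows "total_degree (f * g) = total_degree f + total_degree g"
proof (rule antisym)
  let ?a = "total_degree f" and ?b = "total_degree g"
  have "f * g \<noteq> 0" using assms by simp
  then obtain l m where lm: "bicoeff (f * g) l m \<noteq> 0" "l + m = total_degree (f * g)"
    by (rule total_degree_attained)
  then obtain i j where ij: "i \<le> l" "j \<le> m" "bicoeff f i j * bicoeff g (l - i) (m - j) \<noteq> 0"
    unfolding bicoeff_mult by (meson atMost_iff sum.not_neutral_contains_not_neutral)
  hence nz: "bicoeff f i j \<noteq> 0" "bicoeff g (l - i) (m - j) \<noteq> 0"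
    by auto
  have "i + j \<le> ?a" "(l - i) + (m - j) \<le> ?b"
    by (rule le_total_degree[OF nz(1)], rule le_total_degree[OF nz(2)])
  thus "total_degree (f * g) \<le> ?a + ?b"
    using lm(2) ij(1,2) by simp

  have top: "\<exists>l. bicoeff p l (total_degree p - l) \<noteq> 0 \<and> l \<le> total_degree p \<and>
      (\<forall>i>l. \<forall>j. i + j = total_degree p \<longrightarrow> bicoeff p i j = 0)"
    if "p \<noteq> 0" for p :: "'a poly poly"
  proof -
    let ?S = "{l. l \<le> total_degree p \<and> bicoeff p l (total_degree p - l) \<noteq> 0}"
    obtain l0 m0 where l0: "bicoeff p l0 m0 \<noteq> 0" "l0 + m0 = total_degree p"
      using total_degree_attained[OF \<open>p \<noteq> 0\<close>] by blast
    hence "m0 = total_degree p - l0" by simp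
    hence "l0 \<in> ?S" using l0 by simp
    moreover have fin: "finite ?S" by simp
    ultimately have max: "Max ?S \<in> ?S"
      using Max_in[of ?S] by blast
    have "bicoeff p i j = 0" if "i > Max ?S" "i + j = total_degree p" for i j
    proof (rule ccontr)
      assume "bicoeff p i j \<noteq> 0"
      moreover have "total_degree p - i = j" "i \<le> total_degree p"
        using that(2) by simp_all
      ultimately have "i \<in> ?S" by simp
      hence "i \<le> Max ?S" by (rule Max_ge[OF fin])
      with that(1) show False by simp
    qed
    moreover have "Max ?S \<le> total_degree p" "bicoeff p (Max ?S) (total_degree p - Max ?S) \<noteq> 0"
      using max by blast+
    ultimately show ?thesis by blast
  qed
  obtain s where s: "bicoeff f s (?a - s) \<noteq> 0" "s \<le> ?a"
    "\<And>i j. i > s \<Longrightarrow> i + j = ?a \<Longrightarrow> bicoeff f i j = 0"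
    using top[OF assms(1)] by blast
  obtain t where t: "bicoeff g t (?b - t) \<noteq> 0" "t \<le> ?b"
    "\<And>i j. i > t \<Longrightarrow> i + j = ?b \<Longrightarrow> bicoeff g i j = 0"
    using top[OF assms(2)] by blast
  define l m where "l = s + t" and "m = (?a - s) + (?b - t)"
  \<comment> \<open>A second contribution to this coefficient would also consist of two terms of top total degree,
    and one of its exponents of \<open>Y\<close> would be too large.\<close>
  have zero: "bicoeff f i j * bicoeff g (l - i) (m - j) = 0"
    if ij: "i \<le> l" "j \<le> m" "(i, j) \<noteq> (s, ?a - s)" for i j
  proof (rule ccontr)
    assume "bicoeff f i j * bicoeff g (l - i) (m - j) \<noteq> 0"
    hence nz: "bicoeff f i j \<noteq> 0" "bicoeff g (l - i) (m - j) \<noteq> 0" by auto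
    have "i + j \<le> ?a" "(l - i) + (m - j) \<le> ?b"
      by (rule le_total_degree[OF nz(1)], rule le_total_degree[OF nz(2)])
    hence eq: "i + j = ?a" "(l - i) + (m - j) = ?b"
      using ij(1,2) s(2) t(2) by (auto simp: l_def m_def)
    have "i \<le> s" "l - i \<le> t"
      using s(3) t(3) nz eq by (meson not_less)+
    hence "i = s" using ij(1) by (simp add: l_def)
    with eq(1) ij(3) show False by auto
  qed
  have "bicoeff (f * g) l m =
      (\<Sum>(i, j)\<in>{..l} \<times> {..m}. bicoeff f i j * bicoeff g (l - i) (m - j))"
    by (simp add: bicoeff_mult sum.cartesian_product)
  also have "\<dots> = (\<Sum>(i, j)\<in>{(s, ?a - s)}. bicoeff f i j * bicoeff g (l - i) (m - j))"
  proof (rule sum.mono_neutral_right)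
    show "\<forall>x\<in>{..l} \<times> {..m} - {(s, ?a - s)}.
        (case x of (i, j) \<Rightarrow> bicoeff f i j * bicoeff g (l - i) (m - j)) = 0"
    proof
      fix x assume x: "x \<in> {..l} \<times> {..m} - {(s, ?a - s)}"
      obtain i j where ij: "x = (i, j)" by (cases x)
      show "(case x of (i, j) \<Rightarrow> bicoeff f i j * bicoeff g (l - i) (m - j)) = 0"
        using x zero[of i j] unfolding ij by (simp only: prod.case) blast
    qed
  qed (auto simp: l_def m_def)
  also have "\<dots> \<noteq> 0"
    using s(1) t(1) by (simp add: l_def m_def)
  finally have "l + m \<le> total_degree (f * g)"
    by (rule le_total_degree)
  thus "?a + ?b \<le> total_degree (f * g)"
    using s(2) t(2) by (simp add: l_def m_def)
qed

lemma is_unit_iff_total_degree_0: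
  fixes f :: "'a::field poly poly"
  assumes "f \<noteq> 0"
  shows "f dvd 1 \<longleftrightarrow> total_degree f = 0"
proof
  assume "f dvd 1"
  then obtain g where g: "f * g = 1" by (auto elim: dvdE)
  have "bicoeff (1 :: 'a poly poly) l m = 0" if "l + m \<noteq> 0" for l m
    using that by (auto simp: bicoeff_def split: nat.splits)
  then have "total_degree (1 :: 'a poly poly) = 0"
    using total_degree_attained[of "1 :: 'a poly poly"] by (metis one_neq_zero)
  thus "total_degree f = 0"
    using total_degree_mult[OF assms, of g] g by (cases "g = 0") auto
next
  assume "total_degree f = 0"
  hence *: "bicoeff f l m = 0" if "l + m \<noteq> 0" for l m
    using le_total_degree[of f l m] that by auto
  have f: "f = [:[:bicoeff f 0 0:]:]"
    by (rule bicoeff_eqI) (auto simp: bicoeff_def[of "[:_:]"] coeff_pCons * split: nat.splits)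
  hence "bicoeff f 0 0 \<noteq> 0"
    using assms by (metis pCons_0_0)
  thus "f dvd 1"
    by (subst f) (simp add: is_unit_const_poly_iff dvd_field_iff)
qed

lemma total_degree_over_closure: "total_degree (over_closure f) = total_degree f"
proof -
  have "bicoeff (over_closure f) l m = to_ac (bicoeff f l m)" for l m
    by (simp add: bicoeff_def over_closure_def coeff_map_poly)
  thus ?thesis by (simp add: total_degree_def)
qed

lemma irreducible_over_closure_iff_not_reducible:
  assumes "total_degree F \<ge> 1"
  shows "Factorial_Ring.irreducible (over_closure F) \<longleftrightarrow> \<not> reducible_over_closure F"
proof -
  let ?F = "over_closure F"
  have deg: "total_degree ?F \<ge> 1"
    using assms by (simp add: total_degree_over_closure)
  have nz: "?F \<noteq> 0"
  proof
    assume "?F = 0"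
    with deg show False by (simp add: total_degree_def bicoeff_def)
  qed
  have unit: "\<not> ?F dvd 1"
    using deg by (simp add: is_unit_iff_total_degree_0[OF nz])
  have factor: "total_degree ?F = total_degree a + total_degree b \<and>
      (a dvd 1 \<longleftrightarrow> total_degree a = 0) \<and> (b dvd 1 \<longleftrightarrow> total_degree b = 0)"
    if "?F = a * b" for a b
  proof -
    have "a \<noteq> 0" "b \<noteq> 0" using that nz by auto
    thus ?thesis
      using that by (simp add: total_degree_mult is_unit_iff_total_degree_0)
  qed
  show ?thesis
  proof
    assume irr: "Factorial_Ring.irreducible ?F"
    show "\<not> reducible_over_closure F"
    proof
      assume "reducible_over_closure F"
      then obtain a b where ab: "?F = a * b" "1 \<le> total_degree a" "total_degree a < total_degree ?F"
        unfolding reducible_over_closure_def total_degree_over_closure by auto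
      have "\<not> a dvd 1" "\<not> b dvd 1"
        using factor[OF ab(1)] ab(2,3) by auto
      with irreducibleD[OF irr ab(1)] show False by simp
    qed
  next
    assume red: "\<not> reducible_over_closure F"
    show "Factorial_Ring.irreducible ?F"
    proof (rule irreducibleI[OF nz unit], rule ccontr)
      fix a b assume ab: "?F = a * b" "\<not> (a dvd 1 \<or> b dvd 1)"
      hence "1 \<le> total_degree a \<and> total_degree a < total_degree F"
        using factor[OF ab(1)] ab(2) unfolding total_degree_over_closure by auto
      with ab(1) red show False
        unfolding reducible_over_closure_def by auto
    qed
  qed
qed

section \<open>The equivalence\<close>

theorem theorem4p1:
  fixes F :: "'k::field_char_0 poly poly" and D :: nat
  assumes "number_field TYPE('k)"
    and "integral_coeffs F"
    and "Polynomial.lead_coeff F = 1"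
    and "Polynomial.degree F \<ge> 2"
    and "Factorial_Ring.irreducible (over_kX F)"
    and "total_degree F = D"
  shows "(strongly_one_genuine_poly F \<longleftrightarrow> algebraic_elements F = constants F) \<and>
         (algebraic_elements F = constants F \<longleftrightarrow> Factorial_Ring.irreducible (over_closure F)) \<and>
         (\<forall>B. noether_form TYPE('k) D B \<longrightarrow>
            (Factorial_Ring.irreducible (over_closure F) \<longleftrightarrow> form_nonzero B (bicoeff F)))"
proof (intro conjI allI impI)
  note irr = assms(5)
  have algebraic: "algebraic_elements F = constants F \<longleftrightarrow> regular_poly F"
    by (rule algebraic_elements_eq_constants_iff[OF irr])
  show "strongly_one_genuine_poly F \<longleftrightarrow> algebraic_elements F = constants F"
    unfolding algebraic strongly_one_genuine_poly_def
    using strongly_one_genuine_if_regular_poly[OF irr _ assms(4)]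
      regular_poly_if_strongly_one_genuine[OF irr] assms(3) irr by blast
  have "degree F > 0" using assms(4) by simp
  thus "algebraic_elements F = constants F \<longleftrightarrow> Factorial_Ring.irreducible (over_closure F)"
    unfolding algebraic
    using regular_poly_if_irreducible_over_closure[OF assms(3)]
      irreducible_over_closure_if_regular_poly[OF assms(3) _ irr] by blast
next
  fix B assume B: "noether_form TYPE('k) D B"
  \<comment> \<open>The monic term in \<open>Y\<close> bounds the total degree from below, so that \<open>F\<close> is not constant.\<close>
  have "bicoeff F (degree F) 0 \<noteq> 0"
    using assms(3) by (simp add: bicoeff_def)
  hence "total_degree F \<ge> 1"
    using le_total_degree[of F "degree F" 0] assms(4) by simp
  hence "Factorial_Ring.irreducible (over_closure F) \<longleftrightarrow> \<not> reducible_over_closure F"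
    by (rule irreducible_over_closure_iff_not_reducible)
  also have "\<dots> \<longleftrightarrow> form_nonzero B (bicoeff F)"
    using B assms(2,6) unfolding noether_form_def form_nonzero_def by auto
  finally show "Factorial_Ring.irreducible (over_closure F) \<longleftrightarrow> form_nonzero B (bicoeff F)" .
qed

end
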